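(* Let $Z$ be a finite set of $d$ points in $\mathbb{P}^2=\mathbb{P}^2_{\mathbb{C}}$ with dual line arrangement $\mathcal{A}_Z:f_Z=0$, and assume that $$m(\mathcal{A}_Z)\leq mdr(f_Z)+\frac{3}{2}<\frac{d}{2}.$$ Let $p'$ be a generic point in $\mathbb{P}^2$ and consider the new set $Z'=Z\cup\{p'\}$. Then $Z'$ admits an unexpected curve of degree $j$, for any integer $j$ such that $$mdr(f_Z)+1<j\leq d-mdr(f_Z)-2.$$
   Context: Work over $\mathbb{C}$, $S=\mathbb{C}[x,y,z]$. The point $p'$ is generic (with respect to $Z$) if it is not situated on any line $\overline{p_ip_j}$ determined by two distinct points $p_i,p_j\in Z$. Unexpected curves: a finite set $Z\subset\mathbb{P}^2$ admits unexpected curves of degree $j\geq 2$ if, for a generic point $q\in\mathbb{P}^2$ (i.e. for $q$ in a nonempty Zariski open subset), $$h^0(\mathbb{P}^2,\mathcal{O}_{\mathbb{P}^2}(j)\otimes\mathcal{I}(Z+(j-1)q))>\max\left(0,\ h^0(\mathbb{P}^2,\mathcal{O}_{\mathbb{P}^2}(j)\otimes\mathcal{I}(Z))-\binom{j}{2}\right),$$ where $\mathcal{I}(Z)$ is the ideal sheaf of functions vanishing on $Z$ and $\mathcal{I}(Z+(j-1)q)$ is the ideal sheaf of functions vanishing on $Z$ and vanishing to order $j-1$ at $q$. Dual arrangement: a point $(a:b:c)\in\mathbb{P}^2$ is dual to the line $ax+by+cz=0$; $\mathcal{A}_Z$ is the arrangement of the $d$ lines dual to the points of $Z$, and $f_Z\in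 S$ is the product of the corresponding linear forms. $m(\mathcal{A}_Z)$ is the maximal multiplicity of an intersection point of $\mathcal{A}_Z$ (equivalently, the maximal number of collinear points in $Z$), and $mdr(f)$ is the smallest integer $r\geq 0$ such that there is a nontrivial relation $af_x+bf_y+cf_z=0$ with $a,b,c\in S_r$ (homogeneous polynomials of degree $r$, not all zero). *)

theory Defs
  imports "HOL-Analysis.Analysis" "HOL-Library.Poly_Mapping"
begin

text \<open>Polynomials in $S = C[x,y,z]$ are finitely supported functions from exponent vectors to
  coefficients; the variables are indexed by the elements 1, 2, 3 of the numeral type 3.\<close>

type_synonym expon = "3 \<Rightarrow>\<^sub>0 nat"
type_synonym tpoly = "expon \<Rightarrow>\<^sub>0 complex"

definition tp_eval :: "tpoly \<Rightarrow> complex ^ 3 \<Rightarrow> complex" where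
  "tp_eval F v = (\<Sum>m\<in>Poly_Mapping.keys F.
     Poly_Mapping.lookup F m * (\<Prod>i\<in>UNIV. (v $ i) ^ Poly_Mapping.lookup m i))"

definition homog :: "nat \<Rightarrow> tpoly \<Rightarrow> bool" where
  "homog r F \<longleftrightarrow> (\<forall>m\<in>Poly_Mapping.keys F. (\<Sum>i\<in>UNIV. Poly_Mapping.lookup m i) = r)"

text \<open>Where the exponent of the \<open>i\<close>-th variable is 0, the truncated subtraction of exponents is
  harmless because the coefficient is 0.\<close>

definition pdiff :: "3 \<Rightarrow> tpoly \<Rightarrow> tpoly" where
  "pdiff i F = (\<Sum>m\<in>Poly_Mapping.keys F.
     Poly_Mapping.single (m - Poly_Mapping.single i 1)
       (of_nat (Poly_Mapping.lookup m i) * Poly_Mapping.lookup F m))"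

definition tp_scale :: "complex \<Rightarrow> tpoly \<Rightarrow> tpoly" where
  "tp_scale c F = Poly_Mapping.single 0 c * F"

global_interpretation tp: vector_space tp_scale
  defines tp_dim = tp.dim
  by unfold_locales
    (simp_all add: tp_scale_def algebra_simps single_add mult_single flip: mult.assoc)

definition linear_form :: "complex ^ 3 \<Rightarrow> tpoly" where
  "linear_form v = (\<Sum>i\<in>UNIV. Poly_Mapping.single (Poly_Mapping.single i 1) (v $ i))"

definition mdr :: "tpoly \<Rightarrow> nat" where
  "mdr f = (LEAST r. \<exists>a b c. homog r a \<and> homog r b \<and> homog r c \<and>
     \<not> (a = 0 \<and> b = 0 \<and> c = 0) \<and>
     a * pdiff 1 f + b * pdiff 2 f + c * pdiff 3 f = 0)"

text \<open>The complex projective plane: nonzero vectors up to a nonzero factor.\<close>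

definition proj_rel :: "complex ^ 3 \<Rightarrow> complex ^ 3 \<Rightarrow> bool" where
  "proj_rel v w \<longleftrightarrow> v \<noteq> 0 \<and> w \<noteq> 0 \<and> (\<exists>c. c \<noteq> 0 \<and> w = c *s v)"

lemma proj_rel_part_equivp: "part_equivp proj_rel"
proof (rule part_equivpI)
  have "proj_rel (axis 1 1) (axis 1 1)"
    unfolding proj_rel_def by (auto simp: axis_eq_0_iff intro!: exI[of _ 1])
  then show "\<exists>v. proj_rel v v" by blast
  show "symp proj_rel"
  proof (rule sympI)
    fix v w assume "proj_rel v w"
    then obtain c where "v \<noteq> 0" "w \<noteq> 0" "c \<noteq> 0" "w = c *s v"
      unfolding proj_rel_def by blast
    then show "proj_rel w v"
      unfolding proj_rel_def by (auto intro!: exI[of _ "inverse c"])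
  qed
  show "transp proj_rel"
  proof (rule transpI)
    fix u v w assume "proj_rel u v" "proj_rel v w"
    then obtain c d where "u \<noteq> 0" "w \<noteq> 0" "c \<noteq> 0" "d \<noteq> 0" "v = c *s u" "w = d *s v"
      unfolding proj_rel_def by blast
    then show "proj_rel u w"
      unfolding proj_rel_def by (auto intro!: exI[of _ "d * c"])
  qed
qed

quotient_type proj_plane = "complex ^ 3" / partial: proj_rel
  by (rule proj_rel_part_equivp)

text \<open>Below, \<open>rep_proj_plane p\<close> is some choice of homogeneous coordinates of \<open>p\<close>. It enters only
  where the choice is immaterial: in the vanishing of homogeneous polynomials, in linear spans,
  and in the defining polynomial of an arrangement, which it fixes up to a nonzero constant.\<close>

lemma rep_proj_plane_nonzero: "rep_proj_plane p \<noteq> 0"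
  using Quotient3_rep_reflp[OF Quotient3_proj_plane, of p] by (simp add: proj_rel_def)

lemma tp_eval_homog_scale:
  assumes "homog r F"
  shows "tp_eval F (c *s v) = c ^ r * tp_eval F v"
  unfolding tp_eval_def sum_distrib_left
proof (rule sum.cong)
  fix m assume "m \<in> Poly_Mapping.keys F"
  then have "(\<Sum>i\<in>UNIV. Poly_Mapping.lookup m i) = r"
    using assms by (auto simp: homog_def)
  then have "(\<Prod>i\<in>(UNIV::3 set). c ^ Poly_Mapping.lookup m i) = c ^ r"
    by (simp flip: power_sum)
  then show "Poly_Mapping.lookup F m * (\<Prod>i\<in>UNIV. ((c *s v) $ i) ^ Poly_Mapping.lookup m i) =
    c ^ r * (Poly_Mapping.lookup F m * (\<Prod>i\<in>UNIV. (v $ i) ^ Poly_Mapping.lookup m i))"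
    by (simp add: power_mult_distrib prod.distrib)
qed simp

definition vanishes_at :: "tpoly \<Rightarrow> proj_plane \<Rightarrow> bool" where
  "vanishes_at F p \<longleftrightarrow> tp_eval F (rep_proj_plane p) = 0"

definition zariski_closed :: "proj_plane set \<Rightarrow> bool" where
  "zariski_closed C \<longleftrightarrow>
     (\<exists>T. (\<forall>F\<in>T. \<exists>r. homog r F) \<and> C = {q. \<forall>F\<in>T. vanishes_at F q})"

definition zariski_open :: "proj_plane set \<Rightarrow> bool" where
  "zariski_open U \<longleftrightarrow> zariski_closed (- U)"

definition line_through :: "proj_plane \<Rightarrow> proj_plane \<Rightarrow> proj_plane set" where
  "line_through p q = {r. rep_proj_plane r \<in> vec.span {rep_proj_plane p, rep_proj_plane q}}"

definition generic_wrt :: "proj_plane set \<Rightarrow> proj_plane \<Rightarrow> bool" where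
  "generic_wrt Z p' \<longleftrightarrow> (\<forall>p\<in>Z. \<forall>q\<in>Z. p \<noteq> q \<longrightarrow> p' \<notin> line_through p q)"

definition dual_line :: "proj_plane \<Rightarrow> proj_plane set" where
  "dual_line p = {q. vanishes_at (linear_form (rep_proj_plane p)) q}"

definition dual_arrangement :: "proj_plane set \<Rightarrow> proj_plane set set" where
  "dual_arrangement Z = dual_line ` Z"

definition arr_poly :: "proj_plane set \<Rightarrow> tpoly" where
  "arr_poly Z = (\<Prod>p\<in>Z. linear_form (rep_proj_plane p))"

definition point_mult :: "proj_plane set set \<Rightarrow> proj_plane \<Rightarrow> nat" where
  "point_mult A q = card {L \<in> A. q \<in> L}"

text \<open>Intersection points of an arrangement are the points lying on at least two of its lines.\<close>

definition max_mult :: "proj_plane set set \<Rightarrow> nat" where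
  "max_mult A = Max {point_mult A q | q. point_mult A q \<ge> 2}"

text \<open>Vanishing to order \<open>m\<close> at \<open>q\<close> means that all partial derivatives of order less than \<open>m\<close>
  vanish at \<open>q\<close>. For homogeneous \<open>F\<close> (in characteristic 0, by the Euler relation) taking
  derivatives in homogeneous coordinates agrees with taking them in an affine chart around \<open>q\<close>.\<close>

definition vanishes_to_order :: "nat \<Rightarrow> tpoly \<Rightarrow> proj_plane \<Rightarrow> bool" where
  "vanishes_to_order m F q \<longleftrightarrow> (\<forall>a b c. a + b + c < m \<longrightarrow>
     vanishes_at ((pdiff 1 ^^ a) ((pdiff 2 ^^ b) ((pdiff 3 ^^ c) F))) q)"

text \<open>The global sections of \<open>O(j)\<close> are the forms of degree \<open>j\<close>; those of the twisted ideal sheaves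
  of \<open>Z\<close> and of \<open>Z + k q\<close> are the forms satisfying the respective vanishing conditions.\<close>

definition sections_through :: "nat \<Rightarrow> proj_plane set \<Rightarrow> tpoly set" where
  "sections_through j Z = {F. homog j F \<and> (\<forall>p\<in>Z. vanishes_at F p)}"

definition sections_through_fat ::
    "nat \<Rightarrow> proj_plane set \<Rightarrow> nat \<Rightarrow> proj_plane \<Rightarrow> tpoly set" where
  "sections_through_fat j Z k q = {F \<in> sections_through j Z. vanishes_to_order k F q}"

definition admits_unexpected :: "proj_plane set \<Rightarrow> nat \<Rightarrow> bool" where
  "admits_unexpected Z j \<longleftrightarrow> j \<ge> 2 \<and>
     (\<exists>U. zariski_open U \<and> U \<noteq> {} \<and>
       (\<forall>q\<in>U. int (tp_dim (sections_through_fat j Z (j - 1) q)) >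
          max 0 (int (tp_dim (sections_through j Z)) - int (j choose 2))))"

end

theory Submission
  imports Defs "HOL-Computational_Algebra.Polynomial"
begin

text \<open>Let \<open>r = mdr f\<close> and let \<open>\<theta>\<close> be a triple of forms of degree \<open>r\<close> that annihilates \<open>f\<close>. Since \<open>\<theta>\<close> is
  tangent to every line of the arrangement, for a general point \<open>q\<close> the curve
  \<open>x \<cdot> \<theta> (x \<times> q) = 0\<close> has degree \<open>r + 1\<close>, passes through \<open>Z\<close>, and vanishes to order \<open>r\<close> at \<open>q\<close>.
  Adding the line \<open>q p'\<close> and \<open>j - r - 2\<close> arbitrary lines through \<open>q\<close> yields a space of dimension
  \<open>j - r - 1\<close> of curves of degree \<open>j\<close> through \<open>Z'\<close> with multiplicity \<open>j - 1\<close> at \<open>q\<close>.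

  On the other hand at most \<open>r + 1\<close> points of \<open>Z'\<close> are collinear, and \<open>2 j + 1\<close> points of which no
  \<open>j + 2\<close> are collinear impose independent conditions on curves of degree \<open>j\<close>. Applied to
  \<open>j + r + 3 \<le> 2 j + 1\<close> points of \<open>Z'\<close> this bounds the expected dimension by \<open>j - r - 2\<close>.\<close>

section \<open>Evaluation\<close>

abbreviation lookup :: "('a \<Rightarrow>\<^sub>0 'b::zero) \<Rightarrow> 'a \<Rightarrow> 'b" where
  "lookup \<equiv> Poly_Mapping.lookup"

abbreviation keys :: "('a \<Rightarrow>\<^sub>0 'b::zero) \<Rightarrow> 'a set" where
  "keys \<equiv> Poly_Mapping.keys"

lemma tpoly_eq_sum_single: "F = (\<Sum>m\<in>keys F. Poly_Mapping.single m (lookup F m))" for F :: tpoly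
proof (rule poly_mapping_eqI)
  fix n
  have "(\<Sum>m\<in>keys F. lookup (Poly_Mapping.single m (lookup F m)) n) =
      (\<Sum>m\<in>keys F. if m = n then lookup F n else 0)"
    by (rule sum.cong) (auto simp: lookup_single when_def)
  then show "lookup F n = lookup (\<Sum>m\<in>keys F. Poly_Mapping.single m (lookup F m)) n"
    by (simp add: lookup_sum not_in_keys_iff_lookup_eq_zero)
qed

text \<open>Nested over both arguments, it reduces bilinear identities such as
  \<open>tp_eval_mult\<close> and \<open>pdiff_mult\<close> to a pair of monomials.\<close>

lemma tpoly_induct [case_names zero single add]:
  fixes F :: tpoly
  assumes "P 0" and "\<And>m c. P (Poly_Mapping.single m c)" and "\<And>F G. P F \<Longrightarrow> P G \<Longrightarrow> P (F + G)"
  shows "P F"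
proof -
  have "P (\<Sum>m\<in>A. Poly_Mapping.single m (lookup F m))" if "finite A" for A
    using that by (induction A) (auto intro: assms)
  then show ?thesis
    using tpoly_eq_sum_single[of F] by (metis finite_keys)
qed

definition mono_eval :: "expon \<Rightarrow> complex ^ 3 \<Rightarrow> complex" where
  "mono_eval m v = (\<Prod>i\<in>UNIV. (v $ i) ^ lookup m i)"

lemma mono_eval_0 [simp]: "mono_eval 0 v = 1"
  by (simp add: mono_eval_def)

lemma mono_eval_add: "mono_eval (m + n) v = mono_eval m v * mono_eval n v"
  by (simp add: mono_eval_def lookup_add power_add prod.distrib)

text \<open>Gives polynomials with different supports a common index set, so that additivity becomes
  a statement about one finite sum.\<close>

lemma tp_eval_superset:
  assumes "finite A" "keys F \<subseteq> A"
  shows "tp_eval F v = (\<Sum>m\<in>A. lookup F m * mono_eval m v)"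
  unfolding tp_eval_def mono_eval_def using assms
  by (intro sum.mono_neutral_left) (auto simp: not_in_keys_iff_lookup_eq_zero)

lemma tp_eval_single [simp]: "tp_eval (Poly_Mapping.single m c) v = c * mono_eval m v"
  by (subst tp_eval_superset[of "{m}"]) auto

lemma tp_eval_0 [simp]: "tp_eval 0 v = 0"
  by (simp add: tp_eval_def)

lemma tp_eval_1 [simp]: "tp_eval 1 v = 1"
  using tp_eval_single[of 0 1 v] by simp

lemma tp_eval_add [simp]: "tp_eval (F + G) v = tp_eval F v + tp_eval G v"
proof -
  have "keys (F + G) \<subseteq> keys F \<union> keys G"
    by (rule keys_add)
  then show ?thesis
    by (simp add: tp_eval_superset[of "keys F \<union> keys G"] lookup_add distrib_right sum.distrib)
qed

lemma tp_eval_sum [simp]: "tp_eval (\<Sum>x\<in>A. f x) v = (\<Sum>x\<in>A. tp_eval (f x) v)"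
  by (induction A rule: infinite_finite_induct) auto

lemma tp_eval_mult [simp]: "tp_eval (F * G) v = tp_eval F v * tp_eval G v"
proof (induction F rule: tpoly_induct)
  case (single m c)
  show ?case
  proof (induction G rule: tpoly_induct)
    case (single n d)
    show ?case by (simp add: mult_single mono_eval_add)
  qed (simp_all add: algebra_simps)
qed (simp_all add: algebra_simps)

lemma tp_eval_prod [simp]: "tp_eval (\<Prod>x\<in>A. f x) v = (\<Prod>x\<in>A. tp_eval (f x) v)"
  by (induction A rule: infinite_finite_induct) auto

lemma tp_eval_power [simp]: "tp_eval (F ^ n) v = tp_eval F v ^ n"
  by (induction n) auto

lemma tp_eval_scale [simp]: "tp_eval (tp_scale c F) v = c * tp_eval F v"
  by (simp add: tp_scale_def)

text \<open>Kronecker substitution: along \<open>(t, t ^ N, t ^ (N * N))\<close> with \<open>N\<close> exceeding all exponents, distinct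
  monomials become distinct powers of \<open>t\<close>.\<close>

lemma tp_eval_inject:
  assumes "\<And>v. tp_eval F v = 0"
  shows "F = 0"
proof (rule poly_mapping_eqI)
  fix n
  \<comment> \<open>\<open>n\<close> is added so that its coefficient can be read off from
    \<open>P\<close> even when \<open>n\<close> is outside the support.\<close>
  define M where "M = insert n (keys F)"
  have finM: "finite M" by (simp add: M_def)
  have finE: "finite ((\<lambda>(m, i). lookup m i) ` (M \<times> (UNIV :: 3 set)))"
    using finM by simp
  obtain N where N: "\<forall>x\<in>(\<lambda>(m, i). lookup m i) ` (M \<times> (UNIV :: 3 set)). x < N"
    using finE finite_nat_set_iff_bounded by blast
  have less: "lookup m i < N" if "m \<in> M" for m i
    using N that by auto
  define \<phi> where "\<phi> m = lookup m 1 + N * (lookup m 2 + N * lookup m (3::3))" for m :: expon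
  have inj: "inj_on \<phi> M"
  proof (rule inj_onI)
    fix m m' assume m: "m \<in> M" "m' \<in> M" and eq: "\<phi> m = \<phi> m'"
    have "N > 0" using less[OF m(1), of 1] by simp
    \<comment> \<open>The exponents are the base \<open>N\<close> digits of
      \<open>\<phi> k\<close>.\<close>
    have d: "\<phi> k div N = lookup k 2 + N * lookup k 3" "\<phi> k mod N = lookup k 1"
      "(\<phi> k div N) div N = lookup k 3" "(\<phi> k div N) mod N = lookup k 2" if "k \<in> M" for k
      using less[OF that, of 1] less[OF that, of 2] \<open>N > 0\<close> by (simp_all add: \<phi>_def)
    have "lookup m i = lookup m' i" for i
      using d[OF m(1)] d[OF m(2)] eq exhaust_3[of i] by metis
    then show "m = m'" by (rule poly_mapping_eqI)
  qed
  define P :: "complex poly" where "P = (\<Sum>m\<in>M. monom (lookup F m) (\<phi> m))"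
  have "poly P t = 0" for t
  proof -
    define v :: "complex ^ 3" where "v = vector [t, t ^ N, t ^ (N * N)]"
    have "mono_eval m v = t ^ \<phi> m" for m
    proof -
      have "mono_eval m v = t ^ lookup m 1 * ((t ^ N) ^ lookup m 2 * (t ^ (N * N)) ^ lookup m 3)"
        unfolding mono_eval_def v_def UNIV_3 by (simp add: vector_3)
      also have "\<dots> = t ^ \<phi> m"
        unfolding \<phi>_def by (simp only: power_add power_mult distrib_left mult.assoc)
      finally show ?thesis .
    qed
    then have "tp_eval F v = poly P t"
      by (subst tp_eval_superset[of M]) (auto simp: M_def P_def poly_sum poly_monom)
    then show ?thesis using assms[of v] by simp
  qed
  then have "P = 0"
    using poly_all_0_iff_0 by blast
  then have "0 = coeff P (\<phi> n)" by simp
  also have "\<dots> = (\<Sum>m\<in>M. if m = n then lookup F m else 0)"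
    unfolding P_def coeff_sum coeff_monom
    by (rule sum.cong) (use inj in \<open>auto simp: M_def inj_on_def\<close>)
  finally show "lookup F n = lookup 0 n"
    using finM by (simp add: M_def)
qed

section \<open>Homogeneous polynomials\<close>

lemma homog_0 [simp]: "homog r 0"
  by (simp add: homog_def)

lemma homog_1 [simp]: "homog 0 1"
  by (simp add: homog_def)

lemma homog_single: "(\<Sum>i\<in>UNIV. lookup m i) = r \<Longrightarrow> homog r (Poly_Mapping.single m c)"
  by (simp add: homog_def)

lemma homog_add: "homog r F \<Longrightarrow> homog r G \<Longrightarrow> homog r (F + G)"
  using keys_add[of F G] by (auto simp: homog_def)

lemma homog_sum: "(\<And>x. x \<in> A \<Longrightarrow> homog r (f x)) \<Longrightarrow> homog r (\<Sum>x\<in>A. f x)"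
  by (induction A rule: infinite_finite_induct) (auto intro: homog_add)

lemma homog_uminus: "homog r F \<Longrightarrow> homog r (- F)"
  by (simp add: homog_def)

lemma homog_mult: "homog r F \<Longrightarrow> homog s G \<Longrightarrow> homog (r + s) (F * G)"
  using keys_mult[of F G] by (fastforce simp: homog_def lookup_add sum.distrib)

lemma homog_scale: "homog r F \<Longrightarrow> homog r (tp_scale c F)"
  unfolding tp_scale_def using homog_mult[of 0 "Poly_Mapping.single 0 c" r F]
  by (simp add: homog_def split: if_splits)

lemma homog_power: "homog r F \<Longrightarrow> homog (n * r) (F ^ n)"
  by (induction n) (auto intro: homog_mult)

lemma homog_prod: "(\<And>x. x \<in> A \<Longrightarrow> homog (e x) (f x)) \<Longrightarrow> homog (\<Sum>x\<in>A. e x) (\<Prod>x\<in>A. f x)"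
  by (induction A rule: infinite_finite_induct) (auto intro: homog_mult)

lemma homog_linear_form [simp]: "homog 1 (linear_form u)"
  unfolding linear_form_def
  by (intro homog_sum homog_single) (simp add: lookup_single when_def)

section \<open>Partial derivatives\<close>

lemma pdiff_superset:
  assumes "finite A" "keys F \<subseteq> A"
  shows "pdiff i F = (\<Sum>m\<in>A. Poly_Mapping.single (m - Poly_Mapping.single i 1)
       (of_nat (lookup m i) * lookup F m))"
  unfolding pdiff_def using assms
  by (intro sum.mono_neutral_left) (auto simp: not_in_keys_iff_lookup_eq_zero)

lemma pdiff_single:
  "pdiff i (Poly_Mapping.single m c) =
    Poly_Mapping.single (m - Poly_Mapping.single i 1) (of_nat (lookup m i) * c)"
  by (subst pdiff_superset[of "{m}"]) auto

lemma pdiff_0 [simp]: "pdiff i 0 = 0"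
  by (simp add: pdiff_def)

lemma pdiff_1 [simp]: "pdiff i 1 = 0"
  using pdiff_single[of i 0 1] by simp

lemma pdiff_add: "pdiff i (F + G) = pdiff i F + pdiff i G"
proof -
  have "keys (F + G) \<subseteq> keys F \<union> keys G"
    by (rule keys_add)
  then show ?thesis
    by (simp add: pdiff_superset[of "keys F \<union> keys G"] lookup_add distrib_left single_add
        sum.distrib)
qed

lemma pdiff_sum: "pdiff i (\<Sum>x\<in>A. f x) = (\<Sum>x\<in>A. pdiff i (f x))"
  by (induction A rule: infinite_finite_induct) (auto simp: pdiff_add)

text \<open>Moving \<open>n\<close> past the truncated subtraction requires that nothing is
  truncated; in \<open>pdiff_mult\<close> the excluded exponent 0 comes with a zero
  coefficient.\<close>

lemma expon_diff_add:
  fixes m n :: expon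
  assumes "lookup m i \<noteq> 0"
  shows "m - Poly_Mapping.single i 1 + n = m + n - Poly_Mapping.single i 1"
  by (rule poly_mapping_eqI) (use assms in \<open>auto simp: lookup_add lookup_minus lookup_single when_def\<close>)

lemma pdiff_mult: "pdiff i (F * G) = pdiff i F * G + F * pdiff i G"
proof (induction F rule: tpoly_induct)
  case (single m c)
  show ?case
  proof (induction G rule: tpoly_induct)
    case (single n d)
    have 1: "Poly_Mapping.single (m - Poly_Mapping.single i 1 + n) (of_nat (lookup m i) * c * d) =
        Poly_Mapping.single (m + n - Poly_Mapping.single i 1) (of_nat (lookup m i) * c * d)"
      by (cases "lookup m i = 0") (simp_all add: expon_diff_add del: One_nat_def)
    have 2: "Poly_Mapping.single (m + (n - Poly_Mapping.single i 1)) (c * (of_nat (lookup n i) * d)) =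
        Poly_Mapping.single (m + n - Poly_Mapping.single i 1) (c * (of_nat (lookup n i) * d))"
      by (cases "lookup n i = 0") (simp_all add: expon_diff_add add.commute[of m] del: One_nat_def)
    show ?case
      unfolding pdiff_single mult_single 1 2
      by (simp add: lookup_add algebra_simps flip: single_add)
  qed (simp_all add: algebra_simps pdiff_add)
qed (simp_all add: algebra_simps pdiff_add)

lemma homog_pdiff: "homog (Suc r) F \<Longrightarrow> homog r (pdiff i F)"
proof -
  assume F: "homog (Suc r) F"
  have "homog r (Poly_Mapping.single (m - Poly_Mapping.single i 1) (of_nat (lookup m i) * lookup F m))"
    if "m \<in> keys F" for m
  proof (cases "lookup m i = 0")
    case False
    have "m - Poly_Mapping.single i 1 + Poly_Mapping.single i 1 = m"
      by (rule poly_mapping_eqI)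
        (use False in \<open>auto simp: lookup_add lookup_minus lookup_single when_def\<close>)
    then have "(\<Sum>k\<in>UNIV. lookup m k) = (\<Sum>k\<in>UNIV.
        lookup (m - Poly_Mapping.single i 1) k) + (\<Sum>k\<in>UNIV. lookup (Poly_Mapping.single i 1) k)"
      by (metis (no_types, lifting) lookup_add sum.cong sum.distrib)
    also have "(\<Sum>k\<in>UNIV. lookup (Poly_Mapping.single i (1::nat)) k) = 1"
      by (simp add: lookup_single when_def)
    finally show ?thesis
      using F that by (intro homog_single) (simp add: homog_def)
  qed simp
  then show ?thesis
    unfolding pdiff_def by (rule homog_sum)
qed

lemma pdiff_linear_form: "pdiff i (linear_form u) = Poly_Mapping.single 0 (u $ i)"
proof -
  have "pdiff i (linear_form u) = (\<Sum>k\<in>UNIV. if k = i then Poly_Mapping.single 0 (u $ i) else 0)"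
    unfolding linear_form_def pdiff_sum pdiff_single
    by (rule sum.cong) (auto simp: lookup_single when_def)
  then show ?thesis by simp
qed

lemma pdiff_prod:
  "finite A \<Longrightarrow> pdiff i (\<Prod>x\<in>A. f x) = (\<Sum>x\<in>A. pdiff i (f x) * (\<Prod>y\<in>A - {x}. f y))"
proof (induction A rule: finite_induct)
  case (insert a A)
  have "(\<Prod>y\<in>insert a A - {x}. f y) = f a * (\<Prod>y\<in>A - {x}. f y)" if "x \<in> A" for x
  proof -
    have "insert a A - {x} = insert a (A - {x})" using insert that by auto
    then show ?thesis using insert by simp
  qed
  then have "(\<Sum>x\<in>A. pdiff i (f x) * (\<Prod>y\<in>insert a A - {x}. f y)) =
      f a * (\<Sum>x\<in>A. pdiff i (f x) * (\<Prod>y\<in>A - {x}. f y))"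
    by (simp add: sum_distrib_left mult.left_commute)
  moreover have "insert a A - {a} = A" using insert by auto
  ultimately show ?case
    using insert by (simp add: pdiff_mult)
qed simp

section \<open>Order of vanishing\<close>

text \<open>A recursive form of the order of vanishing, admitting partial derivatives in every
  sequence, which suits induction by the Leibniz rule. It implies
  \<open>vanishes_to_order\<close>.\<close>

fun ord_ge :: "nat \<Rightarrow> tpoly \<Rightarrow> complex ^ 3 \<Rightarrow> bool" where
  "ord_ge 0 F v \<longleftrightarrow> True"
| "ord_ge (Suc k) F v \<longleftrightarrow> tp_eval F v = 0 \<and> (\<forall>i. ord_ge k (pdiff i F) v)"

lemma ord_ge_mono: "ord_ge n F v \<Longrightarrow> m \<le> n \<Longrightarrow> ord_ge m F v"
proof (induction n arbitrary: m F)
  case (Suc n)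
  then show ?case by (cases m) auto
qed simp

lemma ord_ge_0 [simp]: "ord_ge n 0 v"
  by (induction n) auto

lemma ord_ge_add: "ord_ge n F v \<Longrightarrow> ord_ge n G v \<Longrightarrow> ord_ge n (F + G) v"
  by (induction n arbitrary: F G) (auto simp: pdiff_add)

lemma ord_ge_sum: "(\<And>x. x \<in> A \<Longrightarrow> ord_ge n (f x) v) \<Longrightarrow> ord_ge n (\<Sum>x\<in>A. f x) v"
  by (induction A rule: infinite_finite_induct) (auto intro: ord_ge_add)

text \<open>By the Leibniz rule each summand of a derivative lowers the order of one factor by at
  most one. If the differentiated factor has order 0, the other factor alone already has order at
  least \<open>k\<close>.\<close>

lemma ord_ge_mult: "ord_ge m F v \<Longrightarrow> ord_ge n G v \<Longrightarrow> ord_ge (m + n) (F * G) v"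
proof (induction "m + n" arbitrary: m n F G)
  case (Suc k)
  have "ord_ge k (pdiff i F * G) v" for i
  proof (cases m)
    case 0
    then show ?thesis
      using Suc.hyps(1)[of 0 k "pdiff i F" G] Suc.hyps(2) Suc.prems ord_ge_mono[of n G v k] by simp
  next
    case (Suc m')
    then show ?thesis
      using Suc.hyps(1)[of m' n "pdiff i F" G] \<open>Suc k = m + n\<close> Suc.prems by simp
  qed
  moreover have "ord_ge k (F * pdiff i G) v" for i
  proof (cases n)
    case 0
    then show ?thesis
      using Suc.hyps(1)[of k 0 F "pdiff i G"] Suc.hyps(2) Suc.prems ord_ge_mono[of m F v k] by simp
  next
    case (Suc n')
    then show ?thesis
      using Suc.hyps(1)[of m n' F "pdiff i G"] \<open>Suc k = m + n\<close> Suc.prems by simp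
  qed
  moreover have "tp_eval F v * tp_eval G v = 0"
    using Suc.prems \<open>Suc k = m + n\<close> by (cases m; cases n) auto
  ultimately have "ord_ge (Suc k) (F * G) v"
    by (auto simp: pdiff_mult intro: ord_ge_add)
  then show ?case using Suc.hyps(2) by simp
qed simp

lemma ord_ge_power: "ord_ge 1 F v \<Longrightarrow> ord_ge n (F ^ n) v"
  by (induction n) (use ord_ge_mult[of 1 F v] in auto)

lemma ord_ge_prod:
  "(\<And>x. x \<in> A \<Longrightarrow> ord_ge (e x) (f x) v) \<Longrightarrow> ord_ge (\<Sum>x\<in>A. e x) (\<Prod>x\<in>A. f x) v"
  by (induction A rule: infinite_finite_induct) (auto intro: ord_ge_mult)

lemma ord_ge_funpow: "ord_ge n F v \<Longrightarrow> ord_ge (n - a) ((pdiff i ^^ a) F) v"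
proof (induction a)
  case (Suc a)
  then show ?case by (cases "n - a") (auto simp: Suc_diff_Suc dest: arg_cong[where f = "\<lambda>x. x - 1"])
qed simp

lemma ord_ge_imp_vanishes_to_order:
  assumes "ord_ge n F (rep_proj_plane q)"
  shows "vanishes_to_order n F q"
  unfolding vanishes_to_order_def vanishes_at_def
proof (intro allI impI)
  fix a b c :: nat assume "a + b + c < n"
  then have "n - c - b - a = Suc (n - c - b - a - 1)" by simp
  moreover have "ord_ge (n - c - b - a) ((pdiff 1 ^^ a) ((pdiff 2 ^^ b) ((pdiff 3 ^^ c) F)))
      (rep_proj_plane q)"
    by (intro ord_ge_funpow assms)
  ultimately show "tp_eval ((pdiff 1 ^^ a) ((pdiff 2 ^^ b) ((pdiff 3 ^^ c) F))) (rep_proj_plane q) = 0"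
    by (metis ord_ge.simps(2))
qed

section \<open>Points and lines\<close>

text \<open>Bilinear, not Hermitian: it is the incidence pairing between a point and the
  coefficients of a line.\<close>

definition bdot :: "complex ^ 3 \<Rightarrow> complex ^ 3 \<Rightarrow> complex" where
  "bdot u v = (\<Sum>i\<in>UNIV. u $ i * v $ i)"

text \<open>For two distinct points these are the coefficients of the line joining them; dually, for
  two lines, the coordinates of their intersection.\<close>

definition crossp :: "complex ^ 3 \<Rightarrow> complex ^ 3 \<Rightarrow> complex ^ 3" where
  "crossp a b = vector [a $ 2 * b $ 3 - a $ 3 * b $ 2,
     a $ 3 * b $ 1 - a $ 1 * b $ 3, a $ 1 * b $ 2 - a $ 2 * b $ 1]"

lemma bdot_3: "bdot u v = u $ 1 * v $ 1 + u $ 2 * v $ 2 + u $ 3 * v $ 3"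
  by (simp add: bdot_def sum_3)

lemma crossp_nth [simp]:
  "crossp a b $ 1 = a $ 2 * b $ 3 - a $ 3 * b $ 2"
  "crossp a b $ 2 = a $ 3 * b $ 1 - a $ 1 * b $ 3"
  "crossp a b $ 3 = a $ 1 * b $ 2 - a $ 2 * b $ 1"
  by (simp_all add: crossp_def vector_3)

lemma tp_eval_linear_form [simp]: "tp_eval (linear_form u) v = bdot u v"
proof -
  have "mono_eval (Poly_Mapping.single k 1) v = v $ k" for k
  proof -
    have "mono_eval (Poly_Mapping.single k 1) v = (\<Prod>i\<in>UNIV. if i = k then v $ i else 1)"
      unfolding mono_eval_def by (rule prod.cong) (auto simp: lookup_single when_def)
    then show ?thesis by simp
  qed
  then show ?thesis
    by (simp add: linear_form_def bdot_def)
qed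

lemma bdot_commute: "bdot u v = bdot v u"
  by (simp add: bdot_def mult.commute)

lemma bdot_scale [simp]: "bdot u (c *s v) = c * bdot u v" "bdot (c *s u) v = c * bdot u v"
  by (simp_all add: bdot_3 algebra_simps)

lemma bdot_crossp_self [simp]:
  "bdot (crossp a b) a = 0" "bdot (crossp a b) b = 0" "bdot a (crossp a b) = 0"
  "bdot b (crossp a b) = 0"
  by (simp_all add: bdot_3 algebra_simps)

lemma bdot_crossp_rotate: "bdot (crossp a b) c = bdot (crossp b c) a"
  by (simp add: bdot_3 algebra_simps)

lemma vec3_eq_iff: "(u :: complex ^ 3) = v \<longleftrightarrow> u $ 1 = v $ 1 \<and> u $ 2 = v $ 2 \<and> u $ 3 = v $ 3"
  by (simp add: vec_eq_iff forall_3)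

lemma bdot_axis [simp]: "bdot (axis i 1) v = v $ i"
proof -
  have "bdot (axis i 1) v = (\<Sum>k\<in>UNIV. if k = i then v $ k else 0)"
    unfolding bdot_def by (rule sum.cong) (auto simp: axis_def)
  then show ?thesis by simp
qed

lemma ex_bdot_nonzero:
  assumes "u \<noteq> 0"
  obtains e where "bdot u e \<noteq> 0"
proof -
  obtain i where "u $ i \<noteq> 0" using assms by (auto simp: vec_eq_iff)
  then have "bdot u (axis i 1) \<noteq> 0" by (simp add: bdot_commute[of u])
  then show ?thesis by (rule that)
qed

lemma crossp_eq_0_imp_parallel:
  assumes "crossp a b = 0" "a \<noteq> 0"
  obtains c where "b = c *s a"
proof -
  have eqs: "a $ 2 * b $ 3 = a $ 3 * b $ 2" "a $ 3 * b $ 1 = a $ 1 * b $ 3"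
    "a $ 1 * b $ 2 = a $ 2 * b $ 1"
    using assms(1) by (simp_all add: vec3_eq_iff)
  consider "a $ 1 \<noteq> 0" | "a $ 2 \<noteq> 0" | "a $ 3 \<noteq> 0"
    using assms(2) by (auto simp: vec3_eq_iff)
  then show ?thesis
  proof cases
    case 1
    then show ?thesis
      using that[of "b $ 1 / a $ 1"] eqs by (simp add: vec3_eq_iff field_simps)
  next
    case 2
    then show ?thesis
      using that[of "b $ 2 / a $ 2"] eqs by (simp add: vec3_eq_iff field_simps)
  next
    case 3
    then show ?thesis
      using that[of "b $ 3 / a $ 3"] eqs by (simp add: vec3_eq_iff field_simps)
  qed
qed

text \<open>The vector triple product. It turns orthogonality of \<open>u\<close> to
  \<open>a\<close> and \<open>b\<close> into parallelism with \<open>crossp a b\<close>.\<close>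

lemma crossp_crossp:
  "crossp (crossp a b) u = bdot a u *s b - bdot b u *s a"
  by (simp add: vec3_eq_iff bdot_3 algebra_simps)

lemma orthogonal_imp_crossp:
  assumes "bdot a u = 0" "bdot b u = 0" "crossp a b \<noteq> 0"
  obtains c where "u = c *s crossp a b"
  using crossp_eq_0_imp_parallel[of "crossp a b" u] assms by (auto simp: crossp_crossp)

lemma proj_rel_rep: "proj_rel (rep_proj_plane p) (rep_proj_plane q) \<longleftrightarrow> p = q"
  using Quotient3_rel_rep[OF Quotient3_proj_plane] by blast

lemma crossp_rep_eq_0_iff: "crossp (rep_proj_plane p) (rep_proj_plane q) = 0 \<longleftrightarrow> p = q"
proof
  assume "crossp (rep_proj_plane p) (rep_proj_plane q) = 0"
  then obtain c where c: "rep_proj_plane q = c *s rep_proj_plane p"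
    using crossp_eq_0_imp_parallel rep_proj_plane_nonzero by metis
  then have "c \<noteq> 0" using rep_proj_plane_nonzero[of q] by auto
  with c have "proj_rel (rep_proj_plane p) (rep_proj_plane q)"
    by (auto simp: proj_rel_def rep_proj_plane_nonzero)
  then show "p = q" by (simp add: proj_rel_rep)
qed (simp add: vec3_eq_iff)

lemma ex_proj_point:
  assumes "u \<noteq> 0"
  obtains q c where "rep_proj_plane q = c *s u" "c \<noteq> 0"
proof -
  have "proj_rel u u" using assms by (auto simp: proj_rel_def intro!: exI[of _ 1])
  then have "proj_rel u (rep_proj_plane (abs_proj_plane u))"
    using Quotient3_rep_abs[OF Quotient3_proj_plane] part_equivp_symp[OF proj_rel_part_equivp]
    by blast
  then show ?thesis using that by (auto simp: proj_rel_def)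
qed

section \<open>Lines given by coefficient vectors\<close>

definition on_line :: "complex ^ 3 \<Rightarrow> proj_plane set" where
  "on_line u = {q. bdot u (rep_proj_plane q) = 0}"

lemma mem_on_line [simp]: "q \<in> on_line u \<longleftrightarrow> bdot u (rep_proj_plane q) = 0"
  by (simp add: on_line_def)

lemma on_line_eq_crossp:
  assumes "p \<in> on_line u" "q \<in> on_line u" "p \<noteq> q" "u \<noteq> 0"
  shows "on_line u = on_line (crossp (rep_proj_plane p) (rep_proj_plane q))"
proof -
  obtain c where "u = c *s crossp (rep_proj_plane p) (rep_proj_plane q)"
    using assms orthogonal_imp_crossp[of "rep_proj_plane p" u "rep_proj_plane q"]
    by (auto simp: crossp_rep_eq_0_iff bdot_commute)
  with assms(4) show ?thesis by auto
qed

text \<open>Links the determinantal description of a line to the span in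
  \<open>line_through\<close>; the coefficients of the combination come from Cramer's rule.\<close>

lemma on_line_crossp_subset_line_through:
  assumes "p \<noteq> q"
  shows "on_line (crossp (rep_proj_plane p) (rep_proj_plane q)) \<subseteq> line_through p q"
proof
  fix r assume r: "r \<in> on_line (crossp (rep_proj_plane p) (rep_proj_plane q))"
  define a b c where "a = rep_proj_plane p" and "b = rep_proj_plane q" and "c = rep_proj_plane r"
  have det: "bdot (crossp a b) c = 0" using r by (simp add: a_def b_def c_def)
  \<comment> \<open>The two sides differ by the determinant \<open>bdot (crossp a b) c\<close> for
    \<open>i = k\<close> and agree identically for \<open>i \<noteq> k\<close>.\<close>
  have cramer: "crossp a b $ i * c $ k = crossp c b $ i * a $ k + crossp a c $ i * b $ k" for i k
  proof -
    have "i = 1 \<or> i = 2 \<or> i = 3" "k = 1 \<or> k = 2 \<or> k = 3" by (rule exhaust_3)+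
    then have "crossp a b $ i * c $ k - (crossp c b $ i * a $ k + crossp a c $ i * b $ k) = 0 \<or>
        crossp a b $ i * c $ k - (crossp c b $ i * a $ k + crossp a c $ i * b $ k) =
          bdot (crossp a b) c"
      by (elim disjE; simp add: bdot_3 algebra_simps)
    then show ?thesis using det by auto
  qed
  have "crossp a b \<noteq> 0" using assms by (simp add: a_def b_def crossp_rep_eq_0_iff)
  then obtain i where i: "crossp a b $ i \<noteq> 0" by (auto simp: vec_eq_iff)
  have "c = (crossp c b $ i / crossp a b $ i) *s a + (crossp a c $ i / crossp a b $ i) *s b"
    using i cramer[of i] by (simp add: vec_eq_iff field_simps)
  also have "\<dots> \<in> vec.span {a, b}"
    by (intro vec.span_add vec.span_scale vec.span_base) auto
  finally show "r \<in> line_through p q"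
    by (simp add: line_through_def a_def b_def c_def)
qed

lemma left_mem_line_through: "p \<in> line_through p q"
  by (simp add: line_through_def vec.span_base)

section \<open>Duality between collinear points and multiplicities of the arrangement\<close>

lemma dual_line_eq: "dual_line p = on_line (rep_proj_plane p)"
  by (simp add: dual_line_def on_line_def vanishes_at_def)

text \<open>Needed to count lines of the arrangement by points of \<open>Z\<close>. The dual lines
  of distinct points meet in \<open>crossp b a\<close>; a line \<open>e\<close> missing that point
  cuts the first dual line in a point off the second.\<close>

lemma inj_dual_line: "inj dual_line"
proof (rule injI)
  fix p q assume eq: "dual_line p = dual_line q"
  show "p = q"
  proof (rule ccontr)
    define a b where "a = rep_proj_plane p" and "b = rep_proj_plane q"
    assume "p \<noteq> q"
    then have "crossp b a \<noteq> 0" by (auto simp: a_def b_def crossp_rep_eq_0_iff)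
    then obtain e where e: "bdot (crossp b a) e \<noteq> 0" by (rule ex_bdot_nonzero)
    have "bdot b (crossp a e) = bdot (crossp b a) e"
      by (simp add: bdot_3 algebra_simps)
    then have ne: "bdot b (crossp a e) \<noteq> 0" using e by simp
    then have "crossp a e \<noteq> 0" by (auto simp: bdot_def)
    then obtain r c where "rep_proj_plane r = c *s crossp a e" "c \<noteq> 0" by (rule ex_proj_point)
    then have "r \<in> dual_line p" "r \<notin> dual_line q"
      using ne by (auto simp: dual_line_eq a_def b_def)
    then show False using eq by simp
  qed
qed

text \<open>The points of \<open>Z\<close> on the line \<open>u\<close> are dual to the lines of the
  arrangement through the point with coordinates \<open>u\<close>.\<close>

lemma card_on_line_le_max_mult:
  assumes "finite Z" "card Z \<ge> 2" "u \<noteq> 0"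
  shows "max_mult (dual_arrangement Z) \<ge> 2"
    and "card {p \<in> Z. p \<in> on_line u} \<le> max_mult (dual_arrangement Z)"
proof -
  define M where "M = {point_mult (dual_arrangement Z) q | q. point_mult (dual_arrangement Z) q \<ge> 2}"
  have "point_mult (dual_arrangement Z) q \<le> card Z" for q
    unfolding point_mult_def dual_arrangement_def using assms(1)
    by (intro order_trans[OF card_mono card_image_le]) auto
  then have "M \<subseteq> {..card Z}" by (auto simp: M_def)
  then have fin: "finite M" by (rule finite_subset) simp
  have mult: "card {p \<in> Z. p \<in> on_line v} \<in> M"
    if v: "v \<noteq> 0" and ge2: "card {p \<in> Z. p \<in> on_line v} \<ge> 2" for v
  proof -
    obtain q c where q: "rep_proj_plane q = c *s v" "c \<noteq> 0" using v by (rule ex_proj_point)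
    have "{L \<in> dual_arrangement Z. q \<in> L} = dual_line ` {p \<in> Z. p \<in> on_line v}"
      using q by (auto simp: dual_arrangement_def dual_line_eq bdot_commute)
    then have "point_mult (dual_arrangement Z) q = card {p \<in> Z. p \<in> on_line v}"
      unfolding point_mult_def by (simp add: card_image inj_on_subset[OF inj_dual_line])
    then show ?thesis using ge2 unfolding M_def by (intro CollectI exI[of _ q]) auto
  qed
  \<comment> \<open>The line joining two points of \<open>Z\<close> makes \<open>M\<close> nonempty,
    so its maximum is at least 2 and also bounds lines with fewer than two points of
    \<open>Z\<close>.\<close>
  obtain p q where pq: "p \<in> Z" "q \<in> Z" "p \<noteq> q"
    using assms(1,2) card_le_Suc0_iff_eq[of Z] by fastforce
  define w where "w = crossp (rep_proj_plane p) (rep_proj_plane q)"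
  have "w \<noteq> 0" using pq by (simp add: w_def crossp_rep_eq_0_iff)
  have "card {p, q} \<le> card {p \<in> Z. p \<in> on_line w}"
    using pq assms(1) by (intro card_mono) (auto simp: w_def)
  then have "2 \<le> card {p \<in> Z. p \<in> on_line w}" using pq by simp
  with mult[OF \<open>w \<noteq> 0\<close>] show ge2: "max_mult (dual_arrangement Z) \<ge> 2"
    unfolding max_mult_def M_def[symmetric] using Max_ge[OF fin] order_trans by blast
  show "card {p \<in> Z. p \<in> on_line u} \<le> max_mult (dual_arrangement Z)"
  proof (cases "card {p \<in> Z. p \<in> on_line u} \<ge> 2")
    case True
    then show ?thesis
      unfolding max_mult_def M_def[symmetric] using Max_ge[OF fin] mult[OF assms(3)] by blast
  next
    case False
    then show ?thesis using ge2 by linarith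
  qed
qed

text \<open>A line through \<open>p'\<close> carries at most one point of \<open>Z\<close> by
  genericity, hence at most two points in total; this is where \<open>2 \<le> n\<close>
  enters.\<close>

lemma card_on_line_insert_generic:
  assumes "finite Z" "generic_wrt Z p'" "u \<noteq> 0" "card {p \<in> Z. p \<in> on_line u} \<le> n" "2 \<le> n"
  shows "card {p \<in> insert p' Z. p \<in> on_line u} \<le> n"
proof (cases "p' \<in> on_line u")
  case False
  then have "{p \<in> insert p' Z. p \<in> on_line u} = {p \<in> Z. p \<in> on_line u}" by auto
  then show ?thesis using assms(4) by simp
next
  case True
  have "p = q" if "p \<in> Z" "q \<in> Z" "p \<in> on_line u" "q \<in> on_line u" for p q
  proof (rule ccontr)
    assume "p \<noteq> q"
    then have "p' \<in> line_through p q"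
      using on_line_eq_crossp[of p u q] on_line_crossp_subset_line_through[of p q] that assms(3) True
      by blast
    then show False using assms(2) that \<open>p \<noteq> q\<close> by (auto simp: generic_wrt_def)
  qed
  then have "card {p \<in> Z. p \<in> on_line u} \<le> Suc 0"
    using assms(1) by (subst card_le_Suc0_iff_eq) auto
  moreover have "{p \<in> insert p' Z. p \<in> on_line u} \<subseteq> insert p' {p \<in> Z. p \<in> on_line u}" by auto
  then have "card {p \<in> insert p' Z. p \<in> on_line u} \<le> card (insert p' {p \<in> Z. p \<in> on_line u})"
    using assms(1) by (intro card_mono) auto
  moreover have "card (insert p' {p \<in> Z. p \<in> on_line u}) \<le> Suc (card {p \<in> Z. p \<in> on_line u})"
    by (rule card_insert_le_m1) auto
  ultimately show ?thesis using assms(5) by linarith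
qed

text \<open>A point of \<open>Z\<close> lies on every line joining it to another point of
  \<open>Z\<close>, and \<open>card Z \<ge> 2\<close> provides another one.\<close>

lemma generic_not_mem:
  assumes "finite Z" "card Z \<ge> 2" "generic_wrt Z p'"
  shows "p' \<notin> Z"
proof
  assume p': "p' \<in> Z"
  have "\<not> Z \<subseteq> {p'}" using assms(2) card_mono[of "{p'}" Z] by auto
  then obtain q where "q \<in> Z" "q \<noteq> p'" by auto
  then show False
    using assms(3) p' left_mem_line_through[of p' q] by (auto simp: generic_wrt_def)
qed

section \<open>Independent conditions\<close>

lemma subspace_sections_through: "tp.subspace (sections_through j Z)"
  unfolding sections_through_def vanishes_at_def
  by (rule tp.subspaceI) (auto intro: homog_add homog_scale)

section \<open>Dimensions of spaces of forms\<close>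

lemma sum_Suc_diff_eq_choose: "(\<Sum>a\<le>j. Suc (j - a)) = (j + 2) choose 2"
proof (induction j)
  case (Suc j)
  then show ?case
    by (subst sum.atMost_Suc_shift) (simp add: numeral_2_eq_2)
qed (simp add: numeral_2_eq_2)

text \<open>The first two exponents determine the third, so the monomials inject into a triangle of
  lattice points.\<close>

lemma monomials_of_degree:
  "finite {m :: expon. (\<Sum>i\<in>UNIV. lookup m i) = j}"
  "card {m :: expon. (\<Sum>i\<in>UNIV. lookup m i) = j} \<le> (j + 2) choose 2"
proof -
  let ?M = "{m :: expon. (\<Sum>i\<in>UNIV. lookup m i) = j}"
  let ?f = "\<lambda>m :: expon. (lookup m 1, lookup m 2)"
  let ?S = "SIGMA a:{..j}. {..j - a}"
  have inj: "inj_on ?f ?M"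
  proof (rule inj_onI)
    fix m n assume "m \<in> ?M" "n \<in> ?M" "?f m = ?f n"
    then have "lookup m 1 = lookup n 1" "lookup m 2 = lookup n 2" "lookup m 3 = lookup n 3"
      by (auto simp: sum_3)
    then show "m = n"
      by (intro poly_mapping_eqI) (metis exhaust_3)
  qed
  have sub: "?f ` ?M \<subseteq> ?S" by (auto simp: sum_3)
  have fin: "finite ?S" by simp
  show "finite ?M" using inj_on_finite[OF inj sub fin] .
  have "card ?M \<le> card ?S" using card_inj_on_le[OF inj sub fin] .
  then show "card ?M \<le> (j + 2) choose 2"
    using sum_Suc_diff_eq_choose[of j] by simp
qed

lemma homog_subset_span_monomials:
  "{F. homog j F} \<subseteq> tp.span ((\<lambda>m. Poly_Mapping.single m 1) ` {m. (\<Sum>i\<in>UNIV. lookup m i) = j})"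
proof
  fix F assume "F \<in> {F. homog j F}"
  then have F: "homog j F" by simp
  have "F = (\<Sum>m\<in>keys F. tp_scale (lookup F m) (Poly_Mapping.single m 1))"
    using tpoly_eq_sum_single[of F] by (simp add: tp_scale_def mult_single)
  also have "\<dots> \<in> tp.span ((\<lambda>m. Poly_Mapping.single m 1) ` {m. (\<Sum>i\<in>UNIV. lookup m i) = j})"
    using F by (intro tp.span_sum tp.span_scale tp.span_base) (auto simp: homog_def)
  finally show "F \<in> tp.span ((\<lambda>m. Poly_Mapping.single m 1) ` {m. (\<Sum>i\<in>UNIV. lookup m i) = j})" .
qed

lemma dim_homog_le:
  assumes "V \<subseteq> {F. homog j F}"
  shows "tp_dim V \<le> (j + 2) choose 2"
proof -
  let ?M = "{m :: expon. (\<Sum>i\<in>UNIV. lookup m i) = j}"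
  have "tp_dim V \<le> card ((\<lambda>m. Poly_Mapping.single m (1::complex)) ` ?M)"
    using assms homog_subset_span_monomials monomials_of_degree(1)
    by (intro tp.dim_le_card) (auto intro: order_trans)
  also have "\<dots> \<le> card ?M" using monomials_of_degree(1) by (rule card_image_le)
  also have "\<dots> \<le> (j + 2) choose 2" by (rule monomials_of_degree(2))
  finally show ?thesis .
qed

text \<open>The polynomial ring is infinite-dimensional, and \<open>card\<close> of an infinite
  basis would be 0. Finiteness is supplied by the monomials of degree \<open>j\<close>, which span
  all forms of that degree.\<close>

lemma independent_imp_card_le_dim_homog:
  assumes "V \<subseteq> {F. homog j F}" "B \<subseteq> V" "tp.independent B"
  shows "card B \<le> tp_dim V" "finite B"
proof -
  obtain B' where B': "B \<subseteq> B'" "B' \<subseteq> V" "tp.independent B'" "V \<subseteq> tp.span B'"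
    using tp.maximal_independent_subset_extend[OF assms(2,3)] .
  have "finite B'"
    using tp.independent_span_bound[OF finite_imageI[OF monomials_of_degree(1)] B'(3)
        order_trans[OF order_trans[OF B'(2) assms(1)] homog_subset_span_monomials]] by simp
  moreover have "card B' = tp_dim V" using B' by (intro tp.basis_card_eq_dim)
  ultimately show "card B \<le> tp_dim V" "finite B"
    using B'(1) card_mono finite_subset by metis+
qed

text \<open>The points of \<open>S\<close> are paired so that the line of each pair misses \<open>w\<close>, that is, points of a
  pair lie on different lines through \<open>w\<close>; taking them from the two most populated lines through
  \<open>w\<close> keeps the numerical hypotheses valid for \<open>k - 1\<close>.\<close>

lemma separating_form:
  assumes "finite S" "w \<notin> S" "card S \<le> 2 * k"
    and "\<And>L. card {x \<in> S. on_line (crossp (rep_proj_plane w) (rep_proj_plane x)) = L} \<le> k"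
  shows "\<exists>F. homog k F \<and> (\<forall>x\<in>S. vanishes_at F x) \<and> \<not> vanishes_at F w"
  using assms
proof (induction k arbitrary: S)
  case 0
  then have "S = {}" by simp
  then show ?case by (intro exI[of _ 1]) (simp add: vanishes_at_def)
next
  case (Suc k)
  define f where "f x = on_line (crossp (rep_proj_plane w) (rep_proj_plane x))" for x
  define cls where "cls L = {x \<in> S. f x = L}" for L
  have fin_cls: "finite (cls L)" for L using Suc.prems(1) by (simp add: cls_def)
  have cls_le: "card (cls L) \<le> Suc k" for L using Suc.prems(4) by (simp add: cls_def f_def)
  \<comment> \<open>The form for \<open>S'\<close> is multiplied by a line \<open>u\<close> that
    contains the removed points and misses \<open>w\<close>.\<close>
  have step: ?case
    if S': "S' \<subseteq> S" "card S' \<le> 2 * k" "\<And>L. card {x \<in> S'. f x = L} \<le> k"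
      and u: "bdot u (rep_proj_plane w) \<noteq> 0" "\<And>x. x \<in> S - S' \<Longrightarrow> bdot u (rep_proj_plane x) = 0"
    for S' u
  proof -
    obtain F where F: "homog k F" "\<forall>x\<in>S'. vanishes_at F x" "\<not> vanishes_at F w"
      using Suc.IH[of S'] S' Suc.prems(1,2) finite_subset[OF S'(1)] by (auto simp: f_def)
    have "homog (Suc k) (linear_form u * F)" using homog_mult[OF homog_linear_form F(1)] by simp
    then show ?thesis
      using F u by (intro exI[of _ "linear_form u * F"]) (auto simp: vanishes_at_def)
  qed
  show ?case
  proof (cases "S = {}")
    case True
    obtain u where "bdot (rep_proj_plane w) u \<noteq> 0"
      using ex_bdot_nonzero[OF rep_proj_plane_nonzero] .
    then show ?thesis using step[of "{}" u] True by (simp add: bdot_commute)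
  next
    case False
    have ex_max: "\<exists>a\<in>A. \<forall>x\<in>A. card (cls (f x)) \<le> card (cls (f a))" if "A \<noteq> {}" "A \<subseteq> S" for A
    proof -
      have "finite A" using that(2) Suc.prems(1) by (rule finite_subset)
      then have "Max ((\<lambda>x. card (cls (f x))) ` A) \<in> (\<lambda>x. card (cls (f x))) ` A"
        using that(1) by (intro Max_in) auto
      then obtain a where "a \<in> A" "card (cls (f a)) = Max ((\<lambda>x. card (cls (f x))) ` A)" by auto
      then show ?thesis using \<open>finite A\<close> by (intro bexI[of _ a]) auto
    qed
    obtain a where a: "a \<in> S" "\<And>x. x \<in> S \<Longrightarrow> card (cls (f x)) \<le> card (cls (f a))"
      using ex_max[OF False] by blast
    have "a \<noteq> w" using a(1) Suc.prems(2) by auto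
    show ?thesis
    proof (cases "cls (f a) = S")
      \<comment> \<open>All of \<open>S\<close> lies on one line through \<open>w\<close>, so
        \<open>S\<close> has at most \<open>Suc k\<close> points and removing \<open>a\<close>
        suffices. The line joining \<open>a\<close> to a point \<open>e\<close> off
        \<open>f a\<close> misses \<open>w\<close>.\<close>
      case True
      have "crossp (rep_proj_plane w) (rep_proj_plane a) \<noteq> 0"
        using \<open>a \<noteq> w\<close> by (auto simp: crossp_rep_eq_0_iff)
      then obtain e where "bdot (crossp (rep_proj_plane w) (rep_proj_plane a)) e \<noteq> 0"
        by (rule ex_bdot_nonzero)
      then have "bdot (crossp (rep_proj_plane a) e) (rep_proj_plane w) \<noteq> 0"
        by (simp add: bdot_crossp_rotate[of "rep_proj_plane w"])
      moreover have card: "card (S - {a}) \<le> k"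
        using cls_le[of "f a"] True a(1) Suc.prems(1) by simp
      moreover have "card {x \<in> S - {a}. f x = L} \<le> card (S - {a})" for L
        using Suc.prems(1) by (intro card_mono) auto
      ultimately show ?thesis
        by (intro step[of "S - {a}" "crossp (rep_proj_plane a) e"]) (auto intro: order_trans)
    next
      case False
      then have "S - cls (f a) \<noteq> {}" by (auto simp: cls_def)
      then obtain b where b: "b \<in> S" "b \<notin> cls (f a)"
        "\<And>x. x \<in> S - cls (f a) \<Longrightarrow> card (cls (f x)) \<le> card (cls (f b))"
        using ex_max[of "S - cls (f a)"] by blast
      have fab: "f a \<noteq> f b" using b by (auto simp: cls_def)
      have "b \<noteq> w" using b(1) Suc.prems(2) by auto
      have "a \<noteq> b" using fab by auto
      show ?thesis
      proof (rule step[of "S - {a, b}" "crossp (rep_proj_plane a) (rep_proj_plane b)"])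
        show "bdot (crossp (rep_proj_plane a) (rep_proj_plane b)) (rep_proj_plane w) \<noteq> 0"
        proof
          assume "bdot (crossp (rep_proj_plane a) (rep_proj_plane b)) (rep_proj_plane w) = 0"
          then have "b \<in> f a"
            by (simp add: f_def bdot_crossp_rotate[of "rep_proj_plane w" "rep_proj_plane a"])
          moreover have "w \<in> f a" by (simp add: f_def)
          ultimately have "f a = f b"
            unfolding f_def using \<open>b \<noteq> w\<close> \<open>a \<noteq> w\<close>
            by (intro on_line_eq_crossp) (auto simp: crossp_rep_eq_0_iff)
          then show False using fab by simp
        qed
        have "card (S - {a, b}) = card S - card {a, b}"
          using a b by (intro card_Diff_subset) auto
        then show "card (S - {a, b}) \<le> 2 * k"
          using Suc.prems(3) \<open>a \<noteq> b\<close> by simp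
        fix L
        have sub: "{x \<in> S - {a, b}. f x = L} \<subseteq> cls L - {a, b}" by (auto simp: cls_def)
        have le: "card {x \<in> S - {a, b}. f x = L} \<le> card (cls L - {a, b})"
          using sub fin_cls by (intro card_mono) auto
        show "card {x \<in> S - {a, b}. f x = L} \<le> k"
        proof (cases "L = f a \<or> L = f b")
          case True
          then have "a \<in> cls L \<or> b \<in> cls L" using a b by (auto simp: cls_def)
          then have "cls L - {a, b} \<subset> cls L" by auto
          then have "card (cls L - {a, b}) < card (cls L)" by (intro psubset_card_mono fin_cls)
          then show ?thesis using le cls_le[of L] by linarith
        next
          \<comment> \<open>A third class is no larger than those of \<open>a\<close> and
            \<open>b\<close>. The three are disjoint, so three times its size is at most
            \<open>card S \<le> 2 * k + 2\<close>, which forces size at most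
            \<open>k\<close>.\<close>
          case other: False
          show ?thesis
          proof (cases "cls L = {}")
            case True
            then show ?thesis using le by simp
          next
            case False
            then obtain x where x: "x \<in> S" "f x = L" by (auto simp: cls_def)
            have "card (cls L) \<le> card (cls (f b))"
              using b(3)[of x] x other by (auto simp: cls_def)
            moreover have "card (cls (f b)) \<le> card (cls (f a))" using a(2)[OF b(1)] .
            moreover have "card (cls (f a) \<union> cls (f b) \<union> cls L) =
                card (cls (f a)) + card (cls (f b)) + card (cls L)"
              using other fab fin_cls by (subst card_Un_disjoint; (subst card_Un_disjoint)?)
                (auto simp: cls_def)
            moreover have "card (cls (f a) \<union> cls (f b) \<union> cls L) \<le> card S"
              using Suc.prems(1) by (intro card_mono) (auto simp: cls_def)
            moreover have "card (cls L - {a, b}) \<le> card (cls L)"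
              using fin_cls by (intro card_mono) auto
            ultimately have "3 * card (cls L) \<le> card S"
              "card {x \<in> S - {a, b}. f x = L} \<le> card (cls L)"
              using le by (simp, metis le_trans)
            then have "3 * card {x \<in> S - {a, b}. f x = L} \<le> 2 * k + 2"
              using Suc.prems(3) by simp
            then show ?thesis by linarith
          qed
        qed
      qed auto
    qed
  qed
qed

text \<open>Adding a point \<open>w\<close> drops the dimension because some form vanishes on
  \<open>W\<close> but not at \<open>w\<close>. \<open>separating_form\<close> applies with
  \<open>k = j\<close>: discounting \<open>w\<close> leaves at most \<open>2 * j\<close> points, and
  at most \<open>j\<close> on each line through \<open>w\<close>.\<close>

lemma independent_conditions:
  assumes "finite W" "card W \<le> 2 * j + 1"
    and "\<And>u. u \<noteq> 0 \<Longrightarrow> card {p \<in> W. p \<in> on_line u} \<le> j + 1"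
  shows "tp_dim (sections_through j W) + card W \<le> (j + 2) choose 2"
  using assms
proof (induction W rule: finite_induct)
  case empty
  then show ?case using dim_homog_le[of "sections_through j {}" j] by (simp add: sections_through_def)
next
  case (insert w W)
  have IH: "tp_dim (sections_through j W) + card W \<le> (j + 2) choose 2"
  proof (rule insert.IH)
    show "card W \<le> 2 * j + 1" using insert.prems(1) insert.hyps by simp
    fix u :: "complex ^ 3" assume "u \<noteq> 0"
    have "card {p \<in> W. p \<in> on_line u} \<le> card {p \<in> insert w W. p \<in> on_line u}"
      using insert.hyps by (intro card_mono) auto
    also have "\<dots> \<le> j + 1" using insert.prems(2) \<open>u \<noteq> 0\<close> .
    finally show "card {p \<in> W. p \<in> on_line u} \<le> j + 1" .
  qed
  have "card {x \<in> W. on_line (crossp (rep_proj_plane w) (rep_proj_plane x)) = L} \<le> j" for L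
  proof (cases "{x \<in> W. on_line (crossp (rep_proj_plane w) (rep_proj_plane x)) = L} = {}")
    case True
    then show ?thesis by (metis card.empty le0)
  next
    case False
    then obtain y where y: "y \<in> W" "on_line (crossp (rep_proj_plane w) (rep_proj_plane y)) = L"
      by auto
    define u where "u = crossp (rep_proj_plane w) (rep_proj_plane y)"
    have "u \<noteq> 0" using y(1) insert.hyps by (auto simp: u_def crossp_rep_eq_0_iff)
    let ?C = "{x \<in> W. on_line (crossp (rep_proj_plane w) (rep_proj_plane x)) = L}"
    have "x \<in> on_line u" if "x \<in> ?C" for x
    proof -
      have "x \<in> on_line (crossp (rep_proj_plane w) (rep_proj_plane x))" by simp
      also have "\<dots> = on_line u" using that y(2) by (simp add: u_def)
      finally show ?thesis .
    qed
    moreover have "w \<in> on_line u" by (simp add: u_def)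
    ultimately have "insert w ?C \<subseteq> {p \<in> insert w W. p \<in> on_line u}" by blast
    then have "card (insert w ?C) \<le> card {p \<in> insert w W. p \<in> on_line u}"
      using insert.hyps by (intro card_mono) auto
    also have "\<dots> \<le> j + 1" using insert.prems(2)[OF \<open>u \<noteq> 0\<close>] .
    finally show ?thesis using insert.hyps by simp
  qed
  then obtain F where F: "homog j F" "\<forall>x\<in>W. vanishes_at F x" "\<not> vanishes_at F w"
    using separating_form[of W w j] insert.hyps insert.prems(1) by auto
  obtain B where B: "B \<subseteq> sections_through j (insert w W)" "tp.independent B"
    "card B = tp_dim (sections_through j (insert w W))"
    using tp.basis_exists by metis
  have "tp.span B \<subseteq> sections_through j (insert w W)"
    using B(1) subspace_sections_through by (rule tp.span_minimal)
  then have "F \<notin> tp.span B" using F(3) by (auto simp: sections_through_def)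
  then have "tp.independent (insert F B)" using B(2) by (rule tp.independent_insertI)
  moreover have "insert F B \<subseteq> sections_through j W"
    using F B(1) by (auto simp: sections_through_def)
  ultimately have "card (insert F B) \<le> tp_dim (sections_through j W)" "finite (insert F B)"
    using independent_imp_card_le_dim_homog[of "sections_through j W" j "insert F B"]
    by (auto simp: sections_through_def)
  moreover have "F \<notin> B" using \<open>F \<notin> tp.span B\<close> tp.span_base by blast
  ultimately have "Suc (tp_dim (sections_through j (insert w W))) \<le> tp_dim (sections_through j W)"
    using B(3) by simp
  then show ?case using IH insert.hyps by simp
qed

section \<open>Jacobian syzygies\<close>

definition tp_subst :: "tpoly \<Rightarrow> (3 \<Rightarrow> tpoly) \<Rightarrow> tpoly" where
  "tp_subst F L = (\<Sum>m\<in>keys F. Poly_Mapping.single 0 (lookup F m) * (\<Prod>i\<in>UNIV. L i ^ lookup m i))"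

lemma tp_eval_subst [simp]: "tp_eval (tp_subst F L) v = tp_eval F (\<chi> i. tp_eval (L i) v)"
  by (simp add: tp_subst_def tp_eval_def[of F])

lemma homog_subst:
  assumes "homog r F" "\<And>i. homog 1 (L i)"
  shows "homog r (tp_subst F L)"
  unfolding tp_subst_def
proof (rule homog_sum)
  fix m assume "m \<in> keys F"
  then have "(\<Sum>i\<in>UNIV. lookup m i * 1) = r" using assms(1) by (simp add: homog_def)
  moreover have "homog (\<Sum>i\<in>UNIV. lookup m i * 1) (\<Prod>i\<in>UNIV. L i ^ lookup m i)"
    by (intro homog_prod homog_power assms(2))
  ultimately show "homog r (Poly_Mapping.single 0 (lookup F m) * (\<Prod>i\<in>UNIV. L i ^ lookup m i))"
    using homog_scale by (simp add: tp_scale_def)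
qed

text \<open>Each monomial becomes a product of \<open>r\<close> factors that vanish at
  \<open>v\<close>.\<close>

lemma ord_ge_subst:
  assumes "homog r F" "\<And>i. tp_eval (L i) v = 0"
  shows "ord_ge r (tp_subst F L) v"
  unfolding tp_subst_def
proof (rule ord_ge_sum)
  fix m assume "m \<in> keys F"
  then have r: "(\<Sum>i\<in>UNIV. lookup m i) = r" using assms(1) by (simp add: homog_def)
  have "ord_ge (\<Sum>i\<in>UNIV. lookup m i) (\<Prod>i\<in>UNIV. L i ^ lookup m i) v"
    by (intro ord_ge_prod ord_ge_power) (simp add: assms(2))
  then show "ord_ge r (Poly_Mapping.single 0 (lookup F m) * (\<Prod>i\<in>UNIV. L i ^ lookup m i)) v"
    using ord_ge_mult[of 0 "Poly_Mapping.single 0 (lookup F m)" v r] r by simp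
qed

definition eval_field :: "(3 \<Rightarrow> tpoly) \<Rightarrow> complex ^ 3 \<Rightarrow> complex ^ 3" where
  "eval_field \<theta> v = (\<chi> i. tp_eval (\<theta> i) v)"

lemma eval_field_scale:
  assumes "\<And>i. homog r (\<theta> i)"
  shows "eval_field \<theta> (c *s v) = c ^ r *s eval_field \<theta> v"
  by (simp add: eval_field_def vec_eq_iff tp_eval_homog_scale[OF assms])

text \<open>Writes the coordinates of \<open>crossp x q\<close> as linear forms in \<open>x\<close>
  for fixed \<open>q\<close>, and as linear forms in \<open>q\<close> for fixed
  \<open>x\<close>.\<close>

lemma cross_forms:
  "(\<chi> i. bdot (crossp q (axis i 1)) x) = crossp x q"
  "(\<chi> i. bdot (crossp (axis i 1) x) q) = crossp x q"
proof -
  have "bdot (crossp q e) x = bdot e (crossp x q)" "bdot (crossp e x) q = bdot e (crossp x q)" for e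
    by (simp_all add: bdot_3 algebra_simps)
  then show "(\<chi> i. bdot (crossp q (axis i 1)) x) = crossp x q"
    "(\<chi> i. bdot (crossp (axis i 1) x) q) = crossp x q"
    by (simp_all add: vec_eq_iff)
qed

text \<open>For a vector field \<open>\<theta>\<close>, the curve \<open>x \<cdot> \<theta> (x \<times> q) = 0\<close> in \<open>x\<close> for fixed \<open>q\<close>, and the same
  expression as a form in \<open>q\<close> for fixed \<open>x\<close>.\<close>

definition syz_curve :: "(3 \<Rightarrow> tpoly) \<Rightarrow> complex ^ 3 \<Rightarrow> tpoly" where
  "syz_curve \<theta> q = (\<Sum>i\<in>UNIV. linear_form (axis i 1) *
     tp_subst (\<theta> i) (\<lambda>k. linear_form (crossp q (axis k 1))))"

definition syz_dual :: "(3 \<Rightarrow> tpoly) \<Rightarrow> complex ^ 3 \<Rightarrow> tpoly" where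
  "syz_dual \<theta> x = (\<Sum>i\<in>UNIV. tp_scale (x $ i)
     (tp_subst (\<theta> i) (\<lambda>k. linear_form (crossp (axis k 1) x))))"

lemma tp_eval_syz_curve: "tp_eval (syz_curve \<theta> q) x = bdot x (eval_field \<theta> (crossp x q))"
  by (simp add: syz_curve_def cross_forms bdot_def[of x] eval_field_def)

lemma tp_eval_syz_dual: "tp_eval (syz_dual \<theta> x) q = bdot x (eval_field \<theta> (crossp x q))"
  by (simp add: syz_dual_def cross_forms bdot_def[of x] eval_field_def)

lemma homog_syz_curve:
  assumes "\<And>i. homog r (\<theta> i)"
  shows "homog (Suc r) (syz_curve \<theta> q)"
  unfolding syz_curve_def plus_1_eq_Suc[symmetric]
  by (intro homog_sum homog_mult homog_linear_form homog_subst assms)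

lemma homog_syz_dual:
  assumes "\<And>i. homog r (\<theta> i)"
  shows "homog r (syz_dual \<theta> x)"
  unfolding syz_dual_def by (intro homog_sum homog_scale homog_subst homog_linear_form assms)

text \<open>The coordinates of \<open>crossp x q\<close> vanish at \<open>x = q\<close>, and each
  \<open>\<theta> i\<close> has degree \<open>r\<close> in them.\<close>

lemma ord_ge_syz_curve:
  assumes "\<And>i. homog r (\<theta> i)"
  shows "ord_ge r (syz_curve \<theta> q) q"
  unfolding syz_curve_def
proof (rule ord_ge_sum)
  fix i
  have "ord_ge r (tp_subst (\<theta> i) (\<lambda>k. linear_form (crossp q (axis k 1)))) q"
    by (intro ord_ge_subst assms) simp
  then show "ord_ge r (linear_form (axis i 1) *
      tp_subst (\<theta> i) (\<lambda>k. linear_form (crossp q (axis k 1)))) q"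
    using ord_ge_mult[of 0 "linear_form (axis i 1)" q r] by simp
qed

section \<open>The polynomial of the arrangement and its syzygies\<close>

lemma linear_form_nonzero: "u \<noteq> 0 \<Longrightarrow> linear_form u \<noteq> 0"
  by (metis ex_bdot_nonzero tp_eval_linear_form tp_eval_0)

lemma arr_poly_nonzero: "finite Z \<Longrightarrow> arr_poly Z \<noteq> 0"
  by (simp add: arr_poly_def linear_form_nonzero rep_proj_plane_nonzero)

lemma tp_eval_arr_poly: "tp_eval (arr_poly Z) v = (\<Prod>p\<in>Z. bdot (rep_proj_plane p) v)"
  by (simp add: arr_poly_def)

lemma homog_arr_poly: "homog (card Z) (arr_poly Z)"
  using homog_prod[of Z "\<lambda>_. 1" "\<lambda>p. linear_form (rep_proj_plane p)", OF homog_linear_form]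
  by (simp add: arr_poly_def)

lemma tp_eval_derivation_arr_poly:
  assumes "finite Z"
  shows "tp_eval (\<Sum>i\<in>UNIV. \<theta> i * pdiff i (arr_poly Z)) v =
    (\<Sum>p\<in>Z. bdot (rep_proj_plane p) (eval_field \<theta> v) * (\<Prod>p'\<in>Z - {p}. bdot (rep_proj_plane p') v))"
proof -
  have "tp_eval (\<Sum>i\<in>UNIV. \<theta> i * pdiff i (arr_poly Z)) v = (\<Sum>i\<in>UNIV. \<Sum>p\<in>Z.
      tp_eval (\<theta> i) v * (rep_proj_plane p $ i * (\<Prod>p'\<in>Z - {p}. bdot (rep_proj_plane p') v)))"
    by (simp add: arr_poly_def pdiff_prod[OF assms] pdiff_linear_form sum_distrib_left)
  also have "\<dots> = (\<Sum>p\<in>Z. \<Sum>i\<in>UNIV.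
      tp_eval (\<theta> i) v * (rep_proj_plane p $ i * (\<Prod>p'\<in>Z - {p}. bdot (rep_proj_plane p') v)))"
    by (rule sum.swap)
  finally show ?thesis
    unfolding bdot_def[of _ "eval_field \<theta> v"]
    by (simp add: eval_field_def sum_distrib_right sum_distrib_left mult_ac)
qed

text \<open>The vectors \<open>crossp a v\<close> lie on the dual line of \<open>p\<close>. There
  every summand of the differentiated product except that of \<open>p\<close> retains the vanishing
  factor of \<open>p\<close>. In terms of \<open>syz_curve\<close>, the curve passes through
  \<open>p\<close>.\<close>

lemma syzygy_tangent:
  assumes "finite Z" "p \<in> Z" "(\<Sum>i\<in>UNIV. \<theta> i * pdiff i (arr_poly Z)) = 0"
  shows "bdot (rep_proj_plane p) (eval_field \<theta> (crossp (rep_proj_plane p) v)) = 0"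
proof -
  define a where "a = rep_proj_plane p"
  \<comment> \<open>The product of the other lines, evaluated at \<open>crossp a v\<close> and read
    as a form in \<open>v\<close>. It is cancelled as a polynomial, which covers the
    \<open>v\<close> where its value is 0 as well.\<close>
  define Q where "Q = (\<Prod>p'\<in>Z - {p}. linear_form (crossp (rep_proj_plane p') a))"
  have "tp_eval (syz_dual \<theta> a * Q) v = 0" for v
  proof -
    have tri: "bdot b (crossp a v) = bdot (crossp b a) v" for b
      by (simp add: bdot_3 algebra_simps)
    have "(\<Sum>s\<in>Z. bdot (rep_proj_plane s) (eval_field \<theta> (crossp a v)) *
        (\<Prod>p'\<in>Z - {s}. bdot (rep_proj_plane p') (crossp a v))) = 0"
      using tp_eval_derivation_arr_poly[OF assms(1), of \<theta> "crossp a v"] assms(3) by simp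
    also have "(\<Sum>s\<in>Z. bdot (rep_proj_plane s) (eval_field \<theta> (crossp a v)) *
        (\<Prod>p'\<in>Z - {s}. bdot (rep_proj_plane p') (crossp a v))) =
        (\<Sum>s\<in>Z. if s = p then bdot a (eval_field \<theta> (crossp a v)) *
          (\<Prod>p'\<in>Z - {p}. bdot (rep_proj_plane p') (crossp a v)) else 0)"
    proof (rule sum.cong)
      fix s assume "s \<in> Z"
      show "bdot (rep_proj_plane s) (eval_field \<theta> (crossp a v)) *
          (\<Prod>p'\<in>Z - {s}. bdot (rep_proj_plane p') (crossp a v)) =
          (if s = p then bdot a (eval_field \<theta> (crossp a v)) *
            (\<Prod>p'\<in>Z - {p}. bdot (rep_proj_plane p') (crossp a v)) else 0)"
      proof (cases "s = p")
        case False
        then have "p \<in> Z - {s}" "bdot (rep_proj_plane p) (crossp a v) = 0"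
          using assms(2) by (auto simp: a_def)
        then have "(\<Prod>p'\<in>Z - {s}. bdot (rep_proj_plane p') (crossp a v)) = 0"
          using assms(1) by (intro prod_zero) auto
        then show ?thesis using False by simp
      qed (simp add: a_def)
    qed simp
    finally show ?thesis
      using assms(1,2) by (simp add: tp_eval_syz_dual Q_def tri)
  qed
  then have "syz_dual \<theta> a * Q = 0" by (rule tp_eval_inject)
  moreover have "Q \<noteq> 0"
    using assms(1) by (auto simp: Q_def a_def crossp_rep_eq_0_iff intro!: linear_form_nonzero)
  ultimately have "syz_dual \<theta> a = 0" by simp
  then show ?thesis
    using tp_eval_syz_dual[of \<theta> a v] by (simp add: a_def)
qed

text \<open>If the curve vanished identically for all \<open>q\<close>, then \<open>\<theta>\<close> would be pointwise a multiple of the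
  Euler field, which by the Euler relation does not annihilate \<open>f\<close>.\<close>

lemma syz_nontrivial:
  assumes "finite Z" "Z \<noteq> {}" "(\<Sum>i\<in>UNIV. \<theta> i * pdiff i (arr_poly Z)) = 0"
    and hom: "\<And>i. homog r (\<theta> i)" and "\<theta> i0 \<noteq> 0"
  obtains x q where "q \<noteq> 0" "bdot x (eval_field \<theta> (crossp x q)) \<noteq> 0"
proof -
  have "\<exists>x q. bdot x (eval_field \<theta> (crossp x q)) \<noteq> 0"
  proof (rule ccontr)
    assume "\<not> ?thesis"
    then have zero: "bdot x (eval_field \<theta> (crossp x q)) = 0" for x q by blast
    \<comment> \<open>The factor \<open>arr_poly Z\<close> settles all points on the arrangement, so
      the argument below may assume that its value at \<open>v\<close> is nonzero.\<close>
    have "tp_eval (arr_poly Z * \<theta> i0) v = 0" for v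
    proof (cases "tp_eval (arr_poly Z) v = 0")
      case False
      then have "v \<noteq> 0"
        using assms(1,2) by (auto simp: tp_eval_arr_poly bdot_def)
      have perp: "bdot (crossp v e) (eval_field \<theta> v) = 0" for e
      proof (cases "crossp e v = 0")
        case True
        then have "crossp v e = 0" by (simp add: vec3_eq_iff mult.commute)
        then show ?thesis by (simp add: bdot_def)
      next
        case False
        then obtain g where "bdot (crossp e v) g \<noteq> 0" by (rule ex_bdot_nonzero)
        then have ne: "bdot e (crossp v g) \<noteq> 0" by (simp add: bdot_3 algebra_simps)
        \<comment> \<open>With \<open>x = crossp v e\<close> and \<open>q = crossp v g\<close>, the
          vector \<open>crossp x q\<close> is a nonzero multiple of \<open>v\<close>, and
          homogeneity of \<open>\<theta>\<close> transfers \<open>zero\<close> to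
          \<open>v\<close>.\<close>
        have "crossp (crossp v e) (crossp v g) = - bdot e (crossp v g) *s v"
          unfolding crossp_crossp by (simp add: vec_eq_iff)
        then obtain c where c: "crossp (crossp v e) (crossp v g) = c *s v" "c \<noteq> 0"
          using ne by (metis neg_equal_0_iff_equal)
        then show ?thesis
          using zero[of "crossp v e" "crossp v g"] by (simp add: eval_field_scale[OF hom])
      qed
      have "bdot (crossp v e) (eval_field \<theta> v) = bdot (crossp (eval_field \<theta> v) v) e" for e
        by (simp add: bdot_3 algebra_simps)
      then have "bdot (crossp (eval_field \<theta> v) v) e = 0" for e using perp by simp
      then have "crossp (eval_field \<theta> v) v = 0" using ex_bdot_nonzero by metis
      then have "crossp v (eval_field \<theta> v) = 0" by (simp add: vec3_eq_iff mult.commute)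
      then obtain g where g: "eval_field \<theta> v = g *s v"
        using \<open>v \<noteq> 0\<close> by (rule crossp_eq_0_imp_parallel)
      have "0 = (\<Sum>p\<in>Z. g * (bdot (rep_proj_plane p) v *
          (\<Prod>p'\<in>Z - {p}. bdot (rep_proj_plane p') v)))"
        using tp_eval_derivation_arr_poly[OF assms(1), of \<theta> v] assms(3) g
        by (simp add: mult.assoc)
      also have "\<dots> = (\<Sum>p\<in>Z. g * tp_eval (arr_poly Z) v)"
        using assms(1) by (intro sum.cong) (auto simp: tp_eval_arr_poly prod.remove)
      finally have "g = 0" using False assms(1,2) by simp
      then have "eval_field \<theta> v $ i0 = 0" using g by simp
      then show ?thesis by (simp add: eval_field_def)
    qed simp
    then have "arr_poly Z * \<theta> i0 = 0" by (rule tp_eval_inject)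
    then show False using arr_poly_nonzero[OF assms(1)] assms(5) by simp
  qed
  then obtain x q where xq: "bdot x (eval_field \<theta> (crossp x q)) \<noteq> 0" by blast
  show ?thesis
  proof (cases "q = 0")
    \<comment> \<open>Here \<open>\<theta>\<close> is evaluated at the origin; \<open>q = x\<close>
      gives the same value and is nonzero.\<close>
    case True
    have "x \<noteq> 0" using xq by (auto simp: bdot_def)
    moreover have "crossp x x = crossp x q" using True by (simp add: vec3_eq_iff)
    ultimately show ?thesis using that[of x x] xq by simp
  qed (use that xq in blast)
qed

text \<open>The minimum in \<open>mdr\<close> is over a nonempty set: the Koszul relation between
  the first two partial derivatives is a syzygy of degree \<open>n\<close>, and if both vanish there
  is a constant one.\<close>

lemma mdr_attained:
  assumes "homog (Suc n) f"
  obtains \<theta> i0 where "\<And>i. homog (mdr f) (\<theta> i)" "\<theta> i0 \<noteq> 0" "(\<Sum>i\<in>UNIV. \<theta> i * pdiff i f) = 0"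
proof -
  let ?P = "\<lambda>r. \<exists>a b c. homog r a \<and> homog r b \<and> homog r c \<and> \<not> (a = 0 \<and> b = 0 \<and> c = 0) \<and>
     a * pdiff 1 f + b * pdiff 2 f + c * pdiff 3 f = 0"
  have "\<exists>r. ?P r"
  proof (cases "pdiff 1 f = 0 \<and> pdiff 2 f = 0")
    case True
    then show ?thesis by (intro exI[of _ 0] exI[of _ 1] exI[of _ 0]) auto
  next
    case False
    then show ?thesis
      using assms by (intro exI[of _ n] exI[of _ "pdiff 2 f"] exI[of _ "- pdiff 1 f"] exI[of _ 0])
        (auto intro: homog_pdiff homog_uminus)
  qed
  then have "?P (mdr f)" unfolding mdr_def by (rule LeastI_ex)
  then obtain a b c where abc: "homog (mdr f) a" "homog (mdr f) b" "homog (mdr f) c"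
    "\<not> (a = 0 \<and> b = 0 \<and> c = 0)" "a * pdiff 1 f + b * pdiff 2 f + c * pdiff 3 f = 0"
    by blast
  define \<theta> :: "3 \<Rightarrow> tpoly" where "\<theta> i = (if i = 1 then a else if i = 2 then b else c)" for i
  have \<theta>: "\<theta> 1 = a" "\<theta> 2 = b" "\<theta> 3 = c" by (simp_all add: \<theta>_def)
  have "homog (mdr f) (\<theta> i)" for i using abc by (simp add: \<theta>_def)
  moreover have "(\<Sum>i\<in>UNIV. \<theta> i * pdiff i f) = 0" using abc(5) by (simp add: sum_3 \<theta>)
  moreover have "\<exists>i. \<theta> i \<noteq> 0" using abc(4) \<theta> by metis
  ultimately show ?thesis using that by blast
qed

section \<open>Curves with a fat point\<close>

text \<open>Two lines through the point \<open>v\<close>. Attaining the values \<open>t\<close> and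
  1 together lets products of the two forms be read as powers of \<open>t\<close>. A nonzero
  coordinate of \<open>v\<close> is used to solve for the lines, the other two to prescribe the
  values.\<close>

lemma ex_two_forms:
  fixes v :: "complex ^ 3"
  assumes "v \<noteq> 0"
  obtains u1 u2 where "bdot u1 v = 0" "bdot u2 v = 0" "\<And>t. \<exists>x. bdot u1 x = t \<and> bdot u2 x = 1"
proof -
  consider "v $ 1 \<noteq> 0" | "v $ 2 \<noteq> 0" | "v $ 3 \<noteq> 0"
    using assms by (auto simp: vec3_eq_iff)
  then show ?thesis
  proof cases
    case 1
    show ?thesis
    proof (rule that[of "vector [- v $ 2 / v $ 1, 1, 0]" "vector [- v $ 3 / v $ 1, 0, 1]"])
      show "\<exists>x. bdot (vector [- v $ 2 / v $ 1, 1, 0]) x = t \<and>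
          bdot (vector [- v $ 3 / v $ 1, 0, 1]) x = 1" for t
        by (rule exI[of _ "vector [0, t, 1]"]) (simp add: bdot_3 vector_3)
    qed (use 1 in \<open>simp_all add: bdot_3 vector_3\<close>)
  next
    case 2
    show ?thesis
    proof (rule that[of "vector [1, - v $ 1 / v $ 2, 0]" "vector [0, - v $ 3 / v $ 2, 1]"])
      show "\<exists>x. bdot (vector [1, - v $ 1 / v $ 2, 0]) x = t \<and>
          bdot (vector [0, - v $ 3 / v $ 2, 1]) x = 1" for t
        by (rule exI[of _ "vector [t, 0, 1]"]) (simp add: bdot_3 vector_3)
    qed (use 2 in \<open>simp_all add: bdot_3 vector_3\<close>)
  next
    case 3
    show ?thesis
    proof (rule that[of "vector [1, 0, - v $ 1 / v $ 3]" "vector [0, 1, - v $ 2 / v $ 3]"])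
      show "\<exists>x. bdot (vector [1, 0, - v $ 1 / v $ 3]) x = t \<and>
          bdot (vector [0, 1, - v $ 2 / v $ 3]) x = 1" for t
        by (rule exI[of _ "vector [t, 1, 0]"]) (simp add: bdot_3 vector_3)
    qed (use 3 in \<open>simp_all add: bdot_3 vector_3\<close>)
  qed
qed

text \<open>\<open>tp.independent\<close> concerns sets, so repetitions in the family are excluded
  first: they would give a relation with coefficients 1 and -1.\<close>

lemma independent_family:
  assumes "finite I" and "\<And>c. (\<Sum>i\<in>I. tp_scale (c i) (b i)) = 0 \<Longrightarrow> \<forall>i\<in>I. c i = 0"
  shows "tp.independent (b ` I)" "card (b ` I) = card I"
proof -
  have inj: "inj_on b I"
  proof (rule inj_onI, rule ccontr)
    fix i k assume ik: "i \<in> I" "k \<in> I" "b i = b k" "i \<noteq> k"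
    define c :: "'a \<Rightarrow> complex" where "c l = (if l = i then 1 else 0) - (if l = k then 1 else 0)" for l
    have "(\<Sum>l\<in>I. tp_scale (c l) (b l)) =
        (\<Sum>l\<in>I. (if l = i then b l else 0) - (if l = k then b l else 0))"
      by (rule sum.cong) (auto simp: c_def tp.scale_left_diff_distrib)
    also have "\<dots> = 0" using ik assms(1) by (simp add: sum_subtractf)
    finally have "c i = 0" using assms(2) ik(1) by blast
    then show False using ik(4) by (simp add: c_def)
  qed
  show "card (b ` I) = card I" using inj by (rule card_image)
  show "tp.independent (b ` I)"
  proof (rule tp.independent_if_scalars_zero)
    fix c x assume "(\<Sum>x\<in>b ` I. tp_scale (c x) x) = 0" "x \<in> b ` I"
    then show "c x = 0"
      using assms(2)[of "\<lambda>i. c (b i)"] by (auto simp: sum.reindex[OF inj])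
  qed (use assms(1) in simp)
qed

text \<open>The products of \<open>G\<close> with \<open>k\<close> lines through \<open>q\<close>.\<close>

lemma dim_sections_through_fat_ge:
  assumes "G \<noteq> 0" "homog n G" "\<And>p. p \<in> Z \<Longrightarrow> vanishes_at G p" "ord_ge s G (rep_proj_plane q)"
  shows "Suc k \<le> tp_dim (sections_through_fat (n + k) Z (s + k) q)"
proof -
  define v where "v = rep_proj_plane q"
  obtain u1 u2 where u: "bdot u1 v = 0" "bdot u2 v = 0" "\<And>t. \<exists>x. bdot u1 x = t \<and> bdot u2 x = 1"
    using ex_two_forms[OF rep_proj_plane_nonzero[of q]] unfolding v_def by metis
  define l1 l2 where "l1 = linear_form u1" and "l2 = linear_form u2"
  define b where "b i = G * (l1 ^ i * l2 ^ (k - i))" for i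
  have ord1: "ord_ge 1 l1 v" "ord_ge 1 l2 v" using u by (simp_all add: l1_def l2_def)
  have hom1: "homog 1 l1" "homog 1 l2" by (simp_all only: l1_def l2_def homog_linear_form)
  have mem: "b i \<in> sections_through_fat (n + k) Z (s + k) q" if "i \<le> k" for i
  proof -
    have "homog (n + (i * 1 + (k - i) * 1)) (b i)"
      unfolding b_def by (intro homog_mult homog_power assms(2) hom1)
    moreover have "ord_ge (s + (i + (k - i))) (b i) v"
      unfolding b_def using assms(4) by (intro ord_ge_mult ord_ge_power ord1) (simp add: v_def)
    ultimately show ?thesis
      using that assms(3) ord_ge_imp_vanishes_to_order
      by (auto simp: sections_through_fat_def sections_through_def vanishes_at_def b_def v_def)
  qed
  have indep: "\<forall>i\<in>{..k}. c i = 0" if sum: "(\<Sum>i\<in>{..k}. tp_scale (c i) (b i)) = 0" for c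
  proof -
    have "G * (\<Sum>i\<le>k. tp_scale (c i) (l1 ^ i * l2 ^ (k - i))) = 0"
      using sum by (simp add: b_def tp_scale_def sum_distrib_left mult_ac)
    then have 0: "(\<Sum>i\<le>k. tp_scale (c i) (l1 ^ i * l2 ^ (k - i))) = 0" using assms(1) by simp
    \<comment> \<open>Restricting to points where the second form is 1 and the first is
      \<open>t\<close> turns the relation into a polynomial in \<open>t\<close> with coefficients
      \<open>c\<close>.\<close>
    have "(\<Sum>i\<le>k. c i * t ^ i) = 0" for t
    proof -
      obtain x where "bdot u1 x = t" "bdot u2 x = 1" using u(3) by blast
      then show ?thesis using arg_cong[OF 0, of "\<lambda>F. tp_eval F x"] by (simp add: l1_def l2_def)
    qed
    then show ?thesis using polyfun_eq_0[of c k] by simp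
  qed
  have "card (b ` {..k}) \<le> tp_dim (sections_through_fat (n + k) Z (s + k) q)"
    using mem independent_family(1)[of "{..k}" b, OF _ indep]
    by (intro independent_imp_card_le_dim_homog(1)[of _ "n + k"])
      (auto simp: sections_through_fat_def sections_through_def)
  then show ?thesis using independent_family(2)[of "{..k}" b, OF _ indep] by simp
qed

section \<open>Comparison of the actual and the expected dimension\<close>

theorem proposition5p3:
  fixes Z :: "proj_plane set" and d j :: nat and p' :: proj_plane
  assumes "finite Z"
    and "card Z = d"
    and "real (max_mult (dual_arrangement Z)) \<le> real (mdr (arr_poly Z)) + 3 / 2"
    and "real (mdr (arr_poly Z)) + 3 / 2 < real d / 2"
    and "generic_wrt Z p'"
    and "int (mdr (arr_poly Z)) + 1 < int j"
    and "int j \<le> int d - int (mdr (arr_poly Z)) - 2"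
  shows "admits_unexpected (Z \<union> {p'}) j"
proof -
  define r where "r = mdr (arr_poly Z)"
  \<comment> \<open>Integrality sharpens the bound \<open>r + 3 / 2\<close> on the multiplicity to
    \<open>r + 1\<close>.\<close>
  have r: "max_mult (dual_arrangement Z) \<le> r + 1" "2 * r + 3 < d" "r + 2 \<le> j" "j + r + 2 \<le> d"
    using assms(3,4,6,7) unfolding r_def by linarith+
  have d2: "card Z \<ge> 2" using r assms(2) by simp
  have p': "p' \<notin> Z" using generic_not_mem[OF assms(1) d2 assms(5)] .
  \<comment> \<open>The required \<open>2 \<le> r + 1\<close> follows since the maximal multiplicity
    is at least 2.\<close>
  have line: "card {p \<in> insert p' Z. p \<in> on_line u} \<le> r + 1" if "u \<noteq> 0" for u
    using card_on_line_le_max_mult[OF assms(1) d2 that] r(1)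
    by (intro card_on_line_insert_generic assms(1,5) that) linarith+

  \<comment> \<open>Enough points exist because \<open>p'\<close> is added to the at least
    \<open>j + r + 2\<close> points of \<open>Z\<close>.\<close>
  have "j + r + 3 \<le> card (insert p' Z)" using r p' assms(1,2) by simp
  then obtain W where W: "W \<subseteq> insert p' Z" "card W = j + r + 3" "finite W"
    by (rule obtain_subset_with_card_n)
  have "tp_dim (sections_through j W) + card W \<le> (j + 2) choose 2"
  proof (rule independent_conditions)
    show "card W \<le> 2 * j + 1" using W r by simp
    fix u :: "complex ^ 3" assume "u \<noteq> 0"
    have "card {p \<in> W. p \<in> on_line u} \<le> card {p \<in> insert p' Z. p \<in> on_line u}"
      using W assms(1) by (intro card_mono) auto
    then show "card {p \<in> W. p \<in> on_line u} \<le> j + 1" using line[OF \<open>u \<noteq> 0\<close>] r by linarith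
  qed (rule W)
  moreover have "tp_dim (sections_through j (insert p' Z)) \<le> tp_dim (sections_through j W)"
  proof -
    obtain B where B: "B \<subseteq> sections_through j (insert p' Z)" "tp.independent B"
      "card B = tp_dim (sections_through j (insert p' Z))"
      using tp.basis_exists by metis
    have "sections_through j (insert p' Z) \<subseteq> sections_through j W"
      using W(1) by (auto simp: sections_through_def)
    then have "card B \<le> tp_dim (sections_through j W)"
      using B by (intro independent_imp_card_le_dim_homog(1)[of _ j]) (auto simp: sections_through_def)
    then show ?thesis using B(3) by simp
  qed
  \<comment> \<open>Subtracting the \<open>j + r + 3\<close> conditions from
    \<open>2 * j + 1\<close> leaves the bound \<open>j - r - 2\<close>.\<close>
  moreover have "(j + 2) choose 2 = (j choose 2) + 2 * j + 1"
    by (simp add: numeral_2_eq_2)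
  ultimately have upper: "int (tp_dim (sections_through j (insert p' Z))) - int (j choose 2) \<le>
      int j - int r - 2"
    using W(2) by linarith

  obtain n where "card Z = Suc n" using d2 by (cases "card Z") auto
  then obtain \<theta> i0 where \<theta>: "\<And>i. homog r (\<theta> i)" "\<theta> i0 \<noteq> 0"
    "(\<Sum>i\<in>UNIV. \<theta> i * pdiff i (arr_poly Z)) = 0"
    using mdr_attained[of n "arr_poly Z"] homog_arr_poly[of Z] unfolding r_def by metis
  have "Z \<noteq> {}" using d2 by auto
  then obtain x0 q0 where xq: "q0 \<noteq> 0" "bdot x0 (eval_field \<theta> (crossp x0 q0)) \<noteq> 0"
    using syz_nontrivial[OF assms(1) _ \<theta>(3,1,2)] by metis
  \<comment> \<open>For \<open>q\<close> in \<open>U\<close> the curve does not pass through the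
    fixed \<open>x0\<close>, which certifies that its equation is not identically zero.\<close>
  define U where "U = {q. \<not> vanishes_at (syz_dual \<theta> x0) q}"
  have "zariski_open U"
    unfolding zariski_open_def zariski_closed_def U_def
    by (rule exI[of _ "{syz_dual \<theta> x0}"]) (auto intro: homog_syz_dual \<theta>(1))
  moreover have "U \<noteq> {}"
  proof -
    obtain q c where "rep_proj_plane q = c *s q0" "c \<noteq> 0" using ex_proj_point[OF xq(1)] .
    moreover have "tp_eval (syz_dual \<theta> x0) (c *s q0) = c ^ r * tp_eval (syz_dual \<theta> x0) q0" for c
      by (rule tp_eval_homog_scale[OF homog_syz_dual[OF \<theta>(1)]])
    moreover have "tp_eval (syz_dual \<theta> x0) q0 \<noteq> 0" using xq(2) by (simp add: tp_eval_syz_dual)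
    ultimately have "q \<in> U" by (simp add: U_def vanishes_at_def)
    then show ?thesis by auto
  qed
  moreover have "int (tp_dim (sections_through_fat j (insert p' Z) (j - 1) q)) >
      max 0 (int (tp_dim (sections_through j (insert p' Z))) - int (j choose 2))" if "q \<in> U" for q
  proof -
    define v where "v = rep_proj_plane q"
    have "tp_eval (syz_curve \<theta> v) x0 \<noteq> 0"
      using that by (simp add: U_def vanishes_at_def tp_eval_syz_dual tp_eval_syz_curve v_def)
    then have "syz_curve \<theta> v \<noteq> 0" by auto
    \<comment> \<open>The line joining \<open>q\<close> and \<open>p'\<close>. As \<open>U\<close>
      may contain \<open>p'\<close>, the case \<open>q = p'\<close> is treated separately, with any
      line through \<open>q\<close>.\<close>
    obtain u where u: "u \<noteq> 0" "bdot u v = 0" "bdot u (rep_proj_plane p') = 0"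
    proof (cases "crossp v (rep_proj_plane p') = 0")
      case True
      then obtain c where c: "rep_proj_plane p' = c *s v"
        using crossp_eq_0_imp_parallel rep_proj_plane_nonzero unfolding v_def by metis
      obtain u1 u2 where "bdot u1 v = 0" "\<And>t. \<exists>x. bdot u1 x = t \<and> bdot u2 x = 1"
        using ex_two_forms[OF rep_proj_plane_nonzero[of q]] unfolding v_def by metis
      moreover from this(2)[of 1] have "u1 \<noteq> 0" by (auto simp: bdot_def)
      ultimately show ?thesis using that[of u1] c by simp
    qed (use that in simp)
    define G where "G = syz_curve \<theta> v * linear_form u"
    \<comment> \<open>\<open>G\<close> has degree \<open>r + 2\<close> and order at least
      \<open>r + 1\<close> at \<open>q\<close>; the remaining \<open>j - r - 2\<close> lines, a true
      difference as \<open>r + 2 \<le> j\<close>, raise these to \<open>j\<close> and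
      \<open>j - 1\<close>.\<close>
    have "Suc (j - r - 2) \<le> tp_dim (sections_through_fat (Suc r + 1 + (j - r - 2)) (insert p' Z)
        (r + 1 + (j - r - 2)) q)"
    proof (rule dim_sections_through_fat_ge)
      show "G \<noteq> 0" using \<open>syz_curve \<theta> v \<noteq> 0\<close> u(1) by (simp add: G_def linear_form_nonzero)
      show "homog (Suc r + 1) G"
        unfolding G_def by (intro homog_mult homog_syz_curve \<theta>(1) homog_linear_form)
      show "ord_ge (r + 1) G (rep_proj_plane q)"
        unfolding G_def v_def[symmetric] by (intro ord_ge_mult ord_ge_syz_curve \<theta>(1)) (simp add: u)
      show "vanishes_at G p" if "p \<in> insert p' Z" for p
        using that u(3) syzygy_tangent[OF assms(1) _ \<theta>(3)]
        by (auto simp: vanishes_at_def G_def tp_eval_syz_curve)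
    qed
    moreover have "Suc r + 1 + (j - r - 2) = j" "r + 1 + (j - r - 2) = j - 1" using r by simp_all
    ultimately have "Suc (j - r - 2) \<le> tp_dim (sections_through_fat j (insert p' Z) (j - 1) q)"
      by (simp only:)
    \<comment> \<open>The lower bound \<open>j - r - 1\<close> is positive and exceeds the upper
      bound \<open>j - r - 2\<close> by one, so it beats both entries of the maximum.\<close>
    then show ?thesis using upper r by linarith
  qed
  moreover have "j \<ge> 2" using r by simp
  ultimately show ?thesis unfolding admits_unexpected_def by auto
qed

end
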